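(* For every $\varepsilon>0$ there is a constant $C(\varepsilon)>0$ such that for each $m\in\mathbb N$, \[\mathrm{BH}^{\mathrm{pol}}_{\ell_{\frac{2m}{m+1},1}}(m)\le C(\varepsilon)(\sqrt2+\varepsilon)^m.\]
   Context: $\mathcal J(m,n)=\{(j_1,\dots,j_m):1\le j_1\le\dots\le j_m\le n\}$; every $m$-homogeneous polynomial on $\mathbb C^n$ is uniquely $P(z)=\sum_{\mathbf j\in\mathcal J(m,n)}c_{\mathbf j}z_{j_1}\cdots z_{j_m}$, and $\|P\|_\infty=\sup_{\|z\|_\infty\le1}|P(z)|$. For finite $I$ and $1<p<\infty$, $\|x\|_{\ell_{p,1}(I)}=\sum_k x_k^*(k^{1/p}-(k-1)^{1/p})$, $x^*$ the non-increasing rearrangement of $(|x_i|)$. $\mathrm{BH}^{\mathrm{pol}}_{X}(m)$ is the best constant $C\ge1$ such that $\|(c_{\mathbf j})_{\mathbf j\in\mathcal J(m,n)}\|_{X}\le C\|P\|_\infty$ for all $n$ and all $m$-homogeneous polynomials $P$ on $\mathbb C^n$. *)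

theory Defs
  imports Complex_Main "HOL-Library.Multiset" "HOL-Library.Extended_Real"
begin

definition Jset :: "nat \<Rightarrow> nat \<Rightarrow> nat list set" where
  "Jset m n = {js. length js = m \<and> sorted js \<and> set js \<subseteq> {1..n}}"

definition hpoly :: "nat \<Rightarrow> nat \<Rightarrow> (nat list \<Rightarrow> complex) \<Rightarrow> (nat \<Rightarrow> complex) \<Rightarrow> complex" where
  "hpoly m n c z = (\<Sum>js\<in>Jset m n. c js * (\<Prod>i<m. z (js ! i)))"

definition supnorm :: "nat \<Rightarrow> nat \<Rightarrow> (nat list \<Rightarrow> complex) \<Rightarrow> real" where
  "supnorm m n c = (SUP z\<in>{z. \<forall>k\<in>{1..n}. cmod (z k) \<le> 1}. cmod (hpoly m n c z))"

definition decr_rearr :: "'a set \<Rightarrow> ('a \<Rightarrow> complex) \<Rightarrow> real list" where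
  "decr_rearr I x = rev (sorted_list_of_multiset (image_mset (\<lambda>i. cmod (x i)) (mset_set I)))"

definition lorentz_norm :: "real \<Rightarrow> 'a set \<Rightarrow> ('a \<Rightarrow> complex) \<Rightarrow> real" where
  "lorentz_norm p I x = (let xs = decr_rearr I x in
     (\<Sum>k<length xs. xs ! k * (real (Suc k) powr (1/p) - real k powr (1/p))))"

text \<open>Bohr radius type constant BH^pol_{l_{p,1}}(m): the best (least) constant C >= 1 with
  ||(c_j)_{j in J(m,n)}||_{l_{p,1}} <= C ||P||_inf for all n and all P; infinity if none exists.\<close>
definition BH_pol_lorentz :: "real \<Rightarrow> nat \<Rightarrow> ereal" where
  "BH_pol_lorentz p m = Inf (ereal ` {C. C \<ge> 1 \<and>
     (\<forall>n c. lorentz_norm p (Jset m n) c \<le> C * supnorm m n c)})"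

end

theory Submission
  imports Defs "HOL-Complex_Analysis.Complex_Analysis" "HOL-Real_Asymp.Real_Asymp"
begin

text \<open>
  Three ingredients combine to a constant of order \<open>m\<^sup>3 (\<surd>2)\<^sup>m\<close>.

  A Blei-type inequality bounds the \<open>\<ell>\<^bsub>p,1\<^esub>\<close> norm, \<open>p = 2m/(m+1)\<close>, by the mixed norms
  \<open>\<Sum>\<^sub>r (\<Sum>\<^bsub>j\<^sub>k=r\<^esub> |c\<^sub>j|\<^sup>2)\<^bsup>1/2\<^esup>\<close>. The Lorentz weights are at most \<open>\<surd>v\<^sub>j\<close> with
  \<open>v\<^sub>j = rank(j)\<^bsup>1/m-1\<^esup>\<close>, and every finite index set \<open>W\<close> satisfies
  \<open>\<Sum>\<^sub>W v \<le> m |W|\<^bsup>1/m\<^esup> \<le> \<Sum>\<^sub>k |\<pi>\<^sub>k W|\<close>, so on average a slice \<open>{j \<in> W. j\<^sub>k = r}\<close> carries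
  \<open>v\<close>-mass at most \<open>m\<close>. Peeling off such light slices one after the other and applying Cauchy-Schwarz
  to each of them gives the inequality.

  Hypercontractivity \<open>\<parallel>P\<parallel>\<^sub>2 \<le> (\<surd>2)\<^sup>m \<parallel>P\<parallel>\<^sub>1\<close> on the torus follows, by Minkowski's inequality in each
  variable, from Carleman's inequality \<open>\<Sum> |a\<^sub>k|\<^sup>2/(k+1) \<le> \<parallel>f\<parallel>\<^sub>1\<^sup>2\<close> and \<open>k + 1 \<le> 2\<^sup>k\<close>. Here all means
  over the torus are replaced by means over \<open>N\<close>-th roots of unity, at the price of a factor \<open>K\<^sup>n\<close> with
  \<open>K\<close> as close to \<open>1\<close> as needed.

  Finally, \<open>\<Sum>\<^sub>r |z\<^sub>r \<partial>\<^sub>r P(z)| \<le> e m \<parallel>P\<parallel>\<^sub>\<infinity>\<close> by the Cauchy estimate on the circle of radius \<open>1/m\<close> for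
  \<open>t \<mapsto> P(z\<^sub>k (1 + t w\<^sub>k))\<close>; the coefficients of \<open>z\<^sub>r \<partial>\<^sub>r P\<close> dominate those \<open>c\<^sub>j\<close> with \<open>r\<close> among the
  entries of \<open>j\<close>.
\<close>

section \<open>Lorentz norms and mixed norms\<close>

text \<open>For \<open>x = (N - 1) / N\<close> in the unit interval and \<open>q \<le> 1\<close> one
  has \<open>x powr q \<ge> x\<close>; multiply by \<open>N powr q\<close>. This controls the
  Lorentz weights.\<close>

lemma powr_diff_concave_upper:
  fixes N :: nat and q :: real
  assumes "N \<ge> 1" "0 < q" "q \<le> 1"
  shows "real N powr q - real (N - 1) powr q \<le> real N powr (q - 1)"
proof (cases "N = 1")
  case False
  define x where "x = real (N - 1) / real N"
  have x: "0 < x" "x \<le> 1" "real (N - 1) = x * real N" and N: "real N > 0"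
    using assms False by (auto simp: x_def divide_simps)
  have "x powr q \<ge> x powr 1"
    using x assms by (intro powr_mono') auto
  hence "x powr q \<ge> 1 - 1 / real N"
    using assms x N by (simp add: x_def of_nat_diff diff_divide_distrib)
  hence "real N powr q * (1 - 1 / real N) \<le> real N powr q * x powr q"
    by (intro mult_left_mono) auto
  also have "\<dots> = real (N - 1) powr q"
    using x N by (simp only: x(3)) (simp add: powr_mult mult.commute)
  finally have "real N powr q - real (N - 1) powr q \<le> real N powr q * (1 / real N)"
    by (simp add: algebra_simps)
  thus ?thesis using N by (simp add: powr_diff)
qed (use assms in auto)

text \<open>Bernoulli's inequality gives \<open>1 - 1/N \<le> (1 - 1/(m N)) ^ m\<close>; take m-th
  roots. The right-hand side telescopes when summed over \<open>N\<close>.\<close>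

lemma powr_root_diff_lower:
  fixes N m :: nat
  assumes "N \<ge> 1" "m \<ge> 1"
  shows "real N powr (1/m - 1) \<le> m * (real N powr (1/m) - real (N - 1) powr (1/m))"
proof -
  define x where "x = real (N - 1) / real N"
  have N: "real N > 0" and m: "real m > 0" using assms by auto
  have x: "0 \<le> x" "x = 1 - 1 / real N" "real (N - 1) = x * real N"
    using assms by (auto simp: x_def divide_simps of_nat_diff)
  define y where "y = 1 - 1 / (m * real N)"
  have y: "y \<ge> 0" 
    using assms mult_mono[of 1 "real m" 1 "real N"] by (simp add: y_def)
  have "1 + real m * (- 1 / (m * real N)) \<le> (1 + (- 1 / (m * real N))) ^ m"
    using y by (intro Bernoulli_inequality) (auto simp: y_def)
  hence "x \<le> y ^ m"
    using m N by (simp add: x y_def)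
  hence "x powr (1/m) \<le> (y ^ m) powr (1/m)"
    using x by (intro powr_mono2) auto
  also have "(y ^ m) powr (1/m) = y"
    using y m assms by (cases "y = 0") (auto simp: powr_realpow[symmetric] powr_powr)
  finally have "1 / real N \<le> m * (1 - x powr (1/m))"
    using m N by (simp add: y_def field_simps)
  hence "real N powr (1/m) * (1 / real N) \<le> real N powr (1/m) * (m * (1 - x powr (1/m)))"
    by (intro mult_left_mono) auto
  also have "\<dots> = m * (real N powr (1/m) - (x * real N) powr (1/m))"
    using N x(1) by (simp add: powr_mult algebra_simps)
  finally show ?thesis using N by (simp add: powr_diff flip: x(3))
qed

text \<open>Delete the element of largest rank. Injectivity makes that rank at least
  \<open>card W - 1\<close>, so its term is at most the telescoping increment. Ranks start at 0,
  hence the \<open>Suc\<close>.\<close>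

lemma sum_powr_ranks_le:
  fixes \<sigma> :: "'a \<Rightarrow> nat" and m :: nat
  assumes "finite W" "inj_on \<sigma> W" "m \<ge> 1"
  shows "(\<Sum>i\<in>W. real (Suc (\<sigma> i)) powr (1/m - 1)) \<le> m * real (card W) powr (1/m)"
  using assms(1,2)
proof (induction "card W" arbitrary: W)
  case (Suc N)
  have ne: "W \<noteq> {}" using Suc.hyps(2) by auto
  obtain j where j: "j \<in> W" "\<sigma> j = Max (\<sigma> ` W)"
    using Max_in[of "\<sigma> ` W"] Suc.prems ne by (metis (no_types, lifting) finite_imageI image_iff image_is_empty)
  have le: "\<sigma> i \<le> \<sigma> j" if "i \<in> W" for i using j Suc.prems that by simp
  have "card (\<sigma> ` W) \<le> card {..\<sigma> j}"
    using le by (intro card_mono) auto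
  hence rank: "Suc N \<le> Suc (\<sigma> j)" using Suc card_image by fastforce
  have "real (Suc (\<sigma> j)) powr (1/m - 1) \<le> real (Suc N) powr (1/m - 1)"
    using rank assms(3) by (intro powr_mono2') auto
  also have "\<dots> \<le> m * (real (Suc N) powr (1/m) - real N powr (1/m))"
    using powr_root_diff_lower[of "Suc N" m] assms(3) by simp
  finally have 1: "real (Suc (\<sigma> j)) powr (1/m - 1) \<le> m * (real (Suc N) powr (1/m) - real N powr (1/m))" .
  have "(\<Sum>i\<in>W - {j}. real (Suc (\<sigma> i)) powr (1/m - 1)) \<le> m * real (card (W - {j})) powr (1/m)"
    using Suc j by (intro Suc.hyps) (auto simp: inj_on_diff)
  moreover have "card (W - {j}) = N" using Suc j by simp
  ultimately show ?case
    using 1 Suc.prems(1) j Suc.hyps(2) by (simp add: sum.remove[of W j] algebra_simps)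
qed auto

section \<open>Projections, light slices and the Blei-type inequality\<close>

text \<open>Coordinates determine a list, so \<open>W\<close> embeds into the product of its
  projections; the arithmetic-geometric mean inequality turns the product of cardinalities into a
  sum.\<close>

lemma card_root_le_sum_card_projections:
  fixes W :: "'b list set"
  assumes "finite W" "\<And>js. js \<in> W \<Longrightarrow> length js = m" "m \<ge> 1"
  shows "real m * real (card W) powr (1/m) \<le> (\<Sum>k<m. real (card ((\<lambda>js. js ! k) ` W)))"
proof -
  let ?P = "PiE {..<m} (\<lambda>k. (\<lambda>js. js ! k) ` W)"
  have "inj_on (\<lambda>js. restrict (\<lambda>k. js ! k) {..<m}) W"
  proof (rule inj_onI)
    fix x y assume xy: "x \<in> W" "y \<in> W" "restrict ((!) x) {..<m} = restrict ((!) y) {..<m}"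
    show "x = y"
    proof (rule nth_equalityI)
      fix i assume "i < length x"
      hence "i < m" using xy assms(2) by auto
        thus "x ! i = y ! i" using fun_cong[OF xy(3), of i] by simp
    qed (use xy assms(2) in auto)
  qed
  moreover have "(\<lambda>js. restrict (\<lambda>k. js ! k) {..<m}) ` W \<subseteq> ?P"
    by (auto simp: PiE_def Pi_def extensional_def restrict_def)
  moreover have "finite ?P" using assms by (intro finite_PiE) auto
  ultimately have "card W \<le> card ?P" by (meson card_inj_on_le)
  also have "card ?P = (\<Prod>k<m. card ((\<lambda>js. js ! k) ` W))" by (simp add: card_PiE)
  finally have "real (card W) \<le> (\<Prod>k<m. real (card ((\<lambda>js. js ! k) ` W)))"
    by (metis of_nat_le_iff of_nat_prod)
  hence "real (card W) powr (1/m) \<le> (\<Prod>k<m. real (card ((\<lambda>js. js ! k) ` W))) powr (1/m)"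
    by (intro powr_mono2) auto
  also have "\<dots> \<le> (\<Sum>k<m. real (card ((\<lambda>js. js ! k) ` W)) / m)"
    using arith_geom_mean[of "{..<m}" "\<lambda>k. real (card ((\<lambda>js. js ! k) ` W))"] assms(3)
    by (simp add: lessThan_empty_iff)
  finally show ?thesis using assms(3) by (simp add: sum_divide_distrib[symmetric] field_simps)
qed

text \<open>The number of slices is the total size of the projections, hence at least
  \<open>m * card W powr (1/m)\<close>. Together they carry mass \<open>m * sum v W\<close>, so they
  cannot all be heavier than \<open>m\<close>.\<close>

lemma exists_light_slice:
  fixes W :: "'b list set" and v :: "'b list \<Rightarrow> real"
  assumes "finite W" "W \<noteq> {}" "\<And>js. js \<in> W \<Longrightarrow> length js = m" "m \<ge> 1"
    and "sum v W \<le> m * real (card W) powr (1/m)"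
  shows "\<exists>k<m. \<exists>r\<in>(\<lambda>js. js ! k) ` W. sum v {js\<in>W. js ! k = r} \<le> m"
proof (rule ccontr)
  assume "\<not> ?thesis"
  hence gt: "sum v {js\<in>W. js ! k = r} > m" if "k < m" "r \<in> (\<lambda>js. js ! k) ` W" for k r
    using that by (meson not_le)
  \<comment> \<open>double counting: every element of \<open>W\<close> lies in exactly \<open>m\<close> slices\<close>
  have "m * (\<Sum>k<m. real (card ((\<lambda>js. js ! k) ` W))) = (\<Sum>k<m. \<Sum>r\<in>(\<lambda>js. js ! k) ` W. real m)"
    by (simp add: sum_distrib_left algebra_simps)
  also have "\<dots> < (\<Sum>k<m. \<Sum>r\<in>(\<lambda>js. js ! k) ` W. sum v {js\<in>W. js ! k = r})"
    using assms gt by (intro sum_strict_mono) (auto simp: lessThan_empty_iff)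
  also have "\<dots> = (\<Sum>k<m. sum v W)"
    using assms by (intro sum.cong sum.image_gen[symmetric] refl)
  also have "\<dots> \<le> m * (m * real (card W) powr (1/m))"
    using assms by (simp add: mult_left_mono)
  finally have "m * (\<Sum>k<m. real (card ((\<lambda>js. js ! k) ` W))) < m * (m * real (card W) powr (1/m))" .
  thus False
    using card_root_le_sum_card_projections[OF assms(1,3,4)] assms(4) by simp
qed

text \<open>Strong induction: remove a light slice \<open>S\<close>, treat it by Cauchy-Schwarz,
  recurse on the rest. The mass bound is assumed for all subsets so that it survives each
  removal.\<close>

lemma sum_mult_sqrt_le_mixed_norms:
  fixes W :: "'b list set" and v b :: "'b list \<Rightarrow> real"
  assumes "finite W" "\<And>js. js \<in> W \<Longrightarrow> length js = m" "m \<ge> 1" "finite U"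
    and "\<And>js k. js \<in> W \<Longrightarrow> k < m \<Longrightarrow> js ! k \<in> U"
    and v: "\<And>js. js \<in> W \<Longrightarrow> v js \<ge> 0"
    and "\<And>W'. W' \<subseteq> W \<Longrightarrow> sum v W' \<le> m * real (card W') powr (1/m)"
  shows "(\<Sum>js\<in>W. b js * sqrt (v js)) \<le>
         sqrt m * (\<Sum>k<m. \<Sum>r\<in>U. L2_set b {js\<in>W. js ! k = r})"
  using assms(1,2,5-7)
proof (induction "card W" arbitrary: W rule: less_induct)
  case less
  show ?case
  proof (cases "W = {}")
    case False
    obtain k0 r0 where kr: "k0 < m" "r0 \<in> (\<lambda>js. js ! k0) ` W" "sum v {js\<in>W. js ! k0 = r0} \<le> m"
      using exists_light_slice[of W m v] less.prems False assms(3) by blast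
    define S where "S = {js\<in>W. js ! k0 = r0}"
    define W' where "W' = W - S"
    have S: "S \<subseteq> W" "S \<noteq> {}" "finite S" using kr less.prems by (auto simp: S_def)
    hence "card W' < card W" using less.prems unfolding W'_def by (intro psubset_card_mono) auto
    hence IH: "(\<Sum>js\<in>W'. b js * sqrt (v js)) \<le> sqrt m * (\<Sum>k<m. \<Sum>r\<in>U. L2_set b {js\<in>W'. js ! k = r})"
      by (rule less.hyps) (use less.prems(1-4) in \<open>auto simp: W'_def intro!: less.prems(5)\<close>)
    have r0: "r0 \<in> U" using kr less.prems by auto
    have mono: "L2_set b {js\<in>W'. js ! k = r} \<le> L2_set b {js\<in>W. js ! k = r}" for k r
      unfolding L2_set_def W'_def using less.prems by (intro real_sqrt_le_mono sum_mono2) auto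
    have "L2_set (\<lambda>js. sqrt (v js)) S = sqrt (sum v S)"
      unfolding L2_set_def using less.prems S by (intro arg_cong[of _ _ sqrt] sum.cong) auto
    also have "\<dots> \<le> sqrt m" using kr by (simp add: S_def)
    finally have vS: "L2_set (\<lambda>js. sqrt (v js)) S \<le> sqrt m" .
    have "(\<Sum>js\<in>S. b js * sqrt (v js)) \<le> (\<Sum>js\<in>S. \<bar>b js\<bar> * \<bar>sqrt (v js)\<bar>)"
      by (intro sum_mono) (metis abs_ge_self abs_mult)
    also have "\<dots> \<le> L2_set b S * L2_set (\<lambda>js. sqrt (v js)) S" by (rule L2_set_mult_ineq)
    also have "\<dots> \<le> L2_set b S * sqrt m" using vS by (intro mult_left_mono) auto
    finally have 1: "(\<Sum>js\<in>S. b js * sqrt (v js)) \<le> sqrt m * L2_set b S" by (simp add: mult.commute)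
    \<comment> \<open>The slice \<open>(k0, r0)\<close> of \<open>W'\<close> is empty, so its norm
      in \<open>W\<close> is free to pay for \<open>S\<close>; all other norms only grow from
      \<open>W'\<close> to \<open>W\<close>. Each norm is thus spent at most once.\<close>
    have empty: "{js\<in>W'. js ! k0 = r0} = {}" by (auto simp: W'_def S_def)
    have "(\<Sum>k<m. \<Sum>r\<in>U. L2_set b {js\<in>W'. js ! k = r}) + L2_set b S
        \<le> (\<Sum>k<m. \<Sum>r\<in>U. L2_set b {js\<in>W. js ! k = r})"
    proof -
      have "(\<Sum>r\<in>U. L2_set b {js\<in>W'. js ! k0 = r}) + L2_set b S \<le> (\<Sum>r\<in>U. L2_set b {js\<in>W. js ! k0 = r})"
        using sum_mono[of "U - {r0}" "\<lambda>r. L2_set b {js\<in>W'. js ! k0 = r}" "\<lambda>r. L2_set b {js\<in>W. js ! k0 = r}"]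
          mono r0 assms(4) empty by (simp add: sum.remove[of U r0] S_def del: Collect_empty_eq)
      moreover have "(\<Sum>k\<in>{..<m} - {k0}. \<Sum>r\<in>U. L2_set b {js\<in>W'. js ! k = r})
          \<le> (\<Sum>k\<in>{..<m} - {k0}. \<Sum>r\<in>U. L2_set b {js\<in>W. js ! k = r})"
        by (intro sum_mono mono)
      ultimately show ?thesis using kr(1) by (simp add: sum.remove[of "{..<m}" k0])
    qed
    hence "sqrt m * (\<Sum>k<m. \<Sum>r\<in>U. L2_set b {js\<in>W'. js ! k = r}) + sqrt m * L2_set b S
        \<le> sqrt m * (\<Sum>k<m. \<Sum>r\<in>U. L2_set b {js\<in>W. js ! k = r})"
      by (metis (no_types, lifting) distrib_left mult_left_mono of_nat_0_le_iff real_sqrt_ge_zero)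
    moreover have "(\<Sum>js\<in>W. b js * sqrt (v js)) = (\<Sum>js\<in>W'. b js * sqrt (v js)) + (\<Sum>js\<in>S. b js * sqrt (v js))"
      unfolding W'_def using S less.prems by (metis sum.subset_diff)
    ultimately show ?thesis using IH 1 by linarith
  qed (auto intro!: mult_nonneg_nonneg sum_nonneg)
qed

section \<open>The Lorentz norm through ranks\<close>

text \<open>Attaches each Lorentz weight to an index instead of a position; ties are broken by
  \<open>sort_key\<close>.\<close>

lemma decr_rearr_enum:
  assumes "finite I"
  obtains js where "distinct js" "set js = I" "decr_rearr I x = map (\<lambda>i. cmod (x i)) js"
proof -
  obtain l where l: "set l = I" "distinct l" using assms finite_distinct_list by blast
  have "mset_set I = mset l" using l mset_set_set by metis
  hence "decr_rearr I x = rev (sort (map (\<lambda>i. cmod (x i)) l))"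
    by (simp add: decr_rearr_def flip: mset_map)
  also have "sort (map (\<lambda>i. cmod (x i)) l) = map (\<lambda>i. cmod (x i)) (sort_key (\<lambda>i. cmod (x i)) l)"
    by (rule properties_for_sort) auto
  finally have "decr_rearr I x = map (\<lambda>i. cmod (x i)) (rev (sort_key (\<lambda>i. cmod (x i)) l))"
    by (simp add: rev_map)
  thus ?thesis using l by (intro that[of "rev (sort_key (\<lambda>i. cmod (x i)) l)"]) auto
qed

lemma lorentz_norm_le_mixed_norms:
  fixes W :: "'b list set" and c :: "'b list \<Rightarrow> complex"
  assumes "finite W" "\<And>js. js \<in> W \<Longrightarrow> length js = m" "m \<ge> 1" "finite U"
    and "\<And>js k. js \<in> W \<Longrightarrow> k < m \<Longrightarrow> js ! k \<in> U"
  shows "lorentz_norm (2 * real m / (real m + 1)) W c \<le>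
         sqrt m * (\<Sum>k<m. \<Sum>r\<in>U. L2_set (\<lambda>js. cmod (c js)) {js\<in>W. js ! k = r})"
proof -
  let ?p = "2 * real m / (real m + 1)"
  obtain l where l: "distinct l" "set l = W" "decr_rearr W c = map (\<lambda>i. cmod (c i)) l"
    using decr_rearr_enum[OF assms(1)] by metis
  define \<sigma> where "\<sigma> = the_inv_into {..<length l} ((!) l)"
  have inj: "inj_on ((!) l) {..<length l}" using l by (auto simp: inj_on_nth)
  have img: "(!) l ` {..<length l} = W" using l(2) by (auto simp: set_conv_nth)
  have \<sigma>: "\<sigma> (l ! k) = k" if "k < length l" for k
    unfolding \<sigma>_def using that inj by (simp add: the_inv_into_f_f)
  have \<sigma>_inj: "inj_on \<sigma> W"
    unfolding \<sigma>_def img[symmetric] by (rule inj_on_the_inv_into[OF inj])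
  define v where "v js = real (Suc (\<sigma> js)) powr (1/m - 1)" for js
  have q: "1 / ?p = (real m + 1) / (2 * real m)" using assms by (simp add: field_simps)
  \<comment> \<open>For this \<open>p\<close> the exponent \<open>1/p - 1\<close> is exactly half
    the exponent in \<open>v\<close>, which is why \<open>sqrt (v js)\<close> dominates the
    weight.\<close>
  have q': "1 / ?p > 0" "1 / ?p \<le> 1" "1 / ?p - 1 = (1/m - 1) / 2"
    using assms(3) by (auto simp: q field_simps)
  have weight: "real (Suc k) powr (1 / ?p) - real k powr (1 / ?p) \<le> sqrt (v (l ! k))"
    if "k < length l" for k
  proof -
    have "real (Suc k) powr (1 / ?p) - real k powr (1 / ?p) \<le> real (Suc k) powr (1 / ?p - 1)"
      using powr_diff_concave_upper[of "Suc k" "1 / ?p"] q' by simp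
    also have "\<dots> = sqrt (v (l ! k))"
      using that unfolding v_def \<sigma>[OF that] q'(3)
      by (subst powr_half_sqrt[symmetric]) (simp_all only: powr_powr powr_ge_zero times_divide_eq_right mult_1_right)
    finally show ?thesis .
  qed
  have "lorentz_norm ?p W c = (\<Sum>k<length l. cmod (c (l ! k)) * (real (Suc k) powr (1 / ?p) - real k powr (1 / ?p)))"
    unfolding lorentz_norm_def l(3) Let_def length_map by (intro sum.cong refl) simp
  also have "\<dots> \<le> (\<Sum>k<length l. cmod (c (l ! k)) * sqrt (v (l ! k)))"
    by (intro sum_mono mult_left_mono weight) auto
  also have "\<dots> = (\<Sum>js\<in>W. cmod (c js) * sqrt (v js))"
    using sum.reindex[OF inj, of "\<lambda>js. cmod (c js) * sqrt (v js)"] img by simp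
  also have "\<dots> \<le> sqrt m * (\<Sum>k<m. \<Sum>r\<in>U. L2_set (\<lambda>js. cmod (c js)) {js\<in>W. js ! k = r})"
  proof (rule sum_mult_sqrt_le_mixed_norms[OF assms(1-5)])
    fix W' assume "W' \<subseteq> W"
    thus "sum v W' \<le> m * real (card W') powr (1/m)"
      unfolding v_def using assms \<sigma>_inj
      by (intro sum_powr_ranks_le) (auto intro: finite_subset inj_on_subset)
  qed (auto simp: v_def)
  finally show ?thesis .
qed

section \<open>Means over roots of unity and Carleman's inequality\<close>

definition roots_of_unity :: "nat \<Rightarrow> complex set" where
  "roots_of_unity N = {z. z ^ N = 1}"

text \<open>The value type is generic because both real moduli and complex coefficient integrals are
  averaged.\<close>

definition circle_mean :: "nat \<Rightarrow> (complex \<Rightarrow> 'a::real_normed_field) \<Rightarrow> 'a" where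
  "circle_mean N \<phi> = (\<Sum>z\<in>roots_of_unity N. \<phi> z) / of_nat N"

lemma roots_of_unity_finite: "N > 0 \<Longrightarrow> finite (roots_of_unity N)"
  by (simp add: roots_of_unity_def finite_roots_unity)

lemma roots_of_unity_card: "N > 0 \<Longrightarrow> card (roots_of_unity N) = N"
  by (simp add: roots_of_unity_def card_roots_unity_eq)

lemma roots_of_unity_norm: "N > 0 \<Longrightarrow> z \<in> roots_of_unity N \<Longrightarrow> cmod z = 1"
  using power_eq_imp_eq_base[of "cmod z" N 1] by (simp add: roots_of_unity_def flip: norm_power)

lemma circle_mean_cis:
  assumes "N > 0"
  shows "circle_mean N \<phi> = (\<Sum>j<N. \<phi> (cis (2 * pi * real j / real N))) / of_nat N"
  unfolding circle_mean_def roots_of_unity_def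
  using sum.reindex_bij_betw[OF Complex.bij_betw_roots_unity[OF assms], of \<phi>] by simp

lemma circle_mean_mono:
  fixes \<phi> \<psi> :: "complex \<Rightarrow> real"
  assumes "\<And>z. z \<in> roots_of_unity N \<Longrightarrow> \<phi> z \<le> \<psi> z"
  shows "circle_mean N \<phi> \<le> circle_mean N \<psi>"
  unfolding circle_mean_def using assms by (intro divide_right_mono sum_mono) auto

lemma circle_mean_cong:
  assumes "\<And>z. z \<in> roots_of_unity N \<Longrightarrow> \<phi> z = \<psi> z"
  shows "circle_mean N \<phi> = circle_mean N \<psi>"
  unfolding circle_mean_def using assms by simp

lemma circle_mean_add: "circle_mean N (\<lambda>z. \<phi> z + \<psi> z) = circle_mean N \<phi> + circle_mean N \<psi>"
  by (simp add: circle_mean_def sum.distrib add_divide_distrib)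

lemma circle_mean_diff: "circle_mean N (\<lambda>z. \<phi> z - \<psi> z) = circle_mean N \<phi> - circle_mean N \<psi>"
  by (simp add: circle_mean_def sum_subtractf diff_divide_distrib)

lemma circle_mean_cmult: "circle_mean N (\<lambda>z. c * \<phi> z) = c * circle_mean N \<phi>"
  by (simp add: circle_mean_def sum_distrib_left)

lemma circle_mean_sum: "circle_mean N (\<lambda>z. \<Sum>i\<in>I. \<phi> i z) = (\<Sum>i\<in>I. circle_mean N (\<phi> i))"
  unfolding circle_mean_def by (subst sum.swap) (simp add: sum_divide_distrib)

lemma circle_mean_const: "N > 0 \<Longrightarrow> circle_mean N (\<lambda>z. c) = c"
  by (simp add: circle_mean_def roots_of_unity_card)

lemma circle_mean_of_real: "circle_mean N (\<lambda>z. of_real (\<phi> z) :: complex) = of_real (circle_mean N \<phi>)"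
  by (simp add: circle_mean_def)

lemma circle_mean_cnj: "cnj (circle_mean N \<phi>) = circle_mean N (\<lambda>z. cnj (\<phi> z))"
  by (simp add: circle_mean_def)

lemma norm_circle_mean_le: "norm (circle_mean N \<phi>) \<le> circle_mean N (\<lambda>z. norm (\<phi> z))"
  unfolding circle_mean_def by (simp add: norm_divide divide_right_mono norm_sum)

lemma circle_mean_nonneg:
  fixes \<phi> :: "complex \<Rightarrow> real"
  shows "(\<And>z. \<phi> z \<ge> 0) \<Longrightarrow> circle_mean N \<phi> \<ge> 0"
  unfolding circle_mean_def by (intro divide_nonneg_nonneg sum_nonneg) auto

text \<open>Rotation by the primitive root \<open>w\<close> permutes the roots and multiplies the
  sum by \<open>w ^ k * cnj w ^ l\<close>. Distinct exponents below \<open>N\<close> give distinct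
  powers of \<open>w\<close>, so the sum vanishes unless \<open>k = l\<close>.\<close>

lemma circle_mean_orthonormal:
  assumes "k < N" "l < N"
  shows "circle_mean N (\<lambda>z. z ^ k * cnj z ^ l) = of_bool (k = l)"
proof (cases "k = l")
  case True
  have "circle_mean N (\<lambda>z. z ^ k * cnj z ^ l) = circle_mean N (\<lambda>z. 1)"
    using assms roots_of_unity_norm[of N] True
    by (intro circle_mean_cong) (simp flip: power_mult_distrib complex_norm_square)
  thus ?thesis using True assms by (simp add: circle_mean_const)
next
  case False
  have N: "N > 0" using assms by auto
  define w where "w = cis (2 * pi / N)"
  define S where "S = (\<Sum>z\<in>roots_of_unity N. z ^ k * cnj z ^ l)"
  have wN: "w ^ N = 1" unfolding w_def Complex.DeMoivre using N by simp
  have ww: "w * cnj w = 1" by (simp add: w_def flip: complex_norm_square)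
  have "bij_betw (\<lambda>z. w * z) (roots_of_unity N) (roots_of_unity N)"
  proof (rule bij_betwI[where g = "\<lambda>z. cnj w * z"])
    have "cnj w ^ N = 1" using wN by (metis complex_cnj_one complex_cnj_power)
    thus "(\<lambda>z. cnj w * z) \<in> roots_of_unity N \<rightarrow> roots_of_unity N"
      by (auto simp: roots_of_unity_def power_mult_distrib)
    show "cnj w * (w * z) = z" "w * (cnj w * z) = z" for z
      using ww by (metis mult.assoc mult.commute mult_1)+
  qed (auto simp: roots_of_unity_def power_mult_distrib wN)
  from sum.reindex_bij_betw[OF this, of "\<lambda>z. z ^ k * cnj z ^ l"]
  have "S = (\<Sum>z\<in>roots_of_unity N. (w * z) ^ k * cnj (w * z) ^ l)" by (simp add: S_def)
  also have "\<dots> = w ^ k * cnj w ^ l * S"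
    by (simp add: S_def sum_distrib_left power_mult_distrib mult_ac)
  finally have "S * w ^ l = (w ^ k * cnj w ^ l * S) * w ^ l" by simp
  also have "\<dots> = w ^ k * (w * cnj w) ^ l * S" by (simp add: power_mult_distrib)
  finally have "S * w ^ l = w ^ k * S" by (simp add: ww)
  moreover have "w ^ l \<noteq> w ^ k"
  proof -
    have e: "w ^ j = exp (2 * of_real pi * \<i> * of_nat j / of_nat N)" for j
      unfolding w_def Complex.DeMoivre by (simp add: cis_conv_exp mult_ac)
    show ?thesis unfolding e using complex_root_unity_eq[of N l k] N assms False by simp
  qed
  ultimately have "S = 0" by (metis mult.commute mult_left_cancel)
  thus ?thesis using False by (simp add: circle_mean_def S_def)
qed

text \<open>Expand the nonnegative mean of the squared modulus of \<open>G - S\<close>, with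
  \<open>S\<close> the projection of \<open>G\<close> onto powers up to \<open>d\<close>;
  \<open>d < N\<close> makes these powers orthonormal.\<close>

lemma circle_mean_bessel:
  fixes G :: "complex \<Rightarrow> complex"
  assumes "d < N"
  shows "(\<Sum>k\<le>d. (cmod (circle_mean N (\<lambda>z. G z * cnj z ^ k)))\<^sup>2) \<le> circle_mean N (\<lambda>z. (cmod (G z))\<^sup>2)"
proof -
  define c where "c k = circle_mean N (\<lambda>z. G z * cnj z ^ k)" for k
  define S where "S z = (\<Sum>k\<le>d. c k * z ^ k)" for z
  let ?n = "\<Sum>k\<le>d. c k * cnj (c k)"
  have GS: "circle_mean N (\<lambda>z. G z * cnj (S z)) = ?n"
  proof -
    have "circle_mean N (\<lambda>z. G z * cnj (S z)) = circle_mean N (\<lambda>z. \<Sum>k\<le>d. cnj (c k) * (G z * cnj z ^ k))"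
      by (simp add: S_def sum_distrib_left mult_ac)
    also have "\<dots> = ?n"
      unfolding circle_mean_sum circle_mean_cmult c_def[symmetric] by (simp add: mult.commute)
    finally show ?thesis .
  qed
  have SG: "circle_mean N (\<lambda>z. S z * cnj (G z)) = ?n"
    using arg_cong[OF GS, of cnj] unfolding circle_mean_cnj by (simp add: mult.commute)
  have SS: "circle_mean N (\<lambda>z. S z * cnj (S z)) = ?n"
  proof -
    have "circle_mean N (\<lambda>z. S z * cnj (S z))
        = circle_mean N (\<lambda>z. \<Sum>k\<le>d. \<Sum>l\<le>d. c k * cnj (c l) * (z ^ k * cnj z ^ l))"
      by (simp add: S_def sum_product mult_ac)
    also have "\<dots> = (\<Sum>k\<le>d. \<Sum>l\<le>d. c k * cnj (c l) * of_bool (k = l))"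
      unfolding circle_mean_sum circle_mean_cmult using assms
      by (intro sum.cong refl) (subst circle_mean_orthonormal, auto)
    also have "\<dots> = ?n" by simp
    finally show ?thesis .
  qed
  have "complex_of_real (circle_mean N (\<lambda>z. (cmod (G z - S z))\<^sup>2))
      = circle_mean N (\<lambda>z. G z * cnj (G z) - G z * cnj (S z) - S z * cnj (G z) + S z * cnj (S z))"
    unfolding circle_mean_of_real[symmetric] complex_norm_square by (simp add: algebra_simps)
  also have "\<dots> = circle_mean N (\<lambda>z. G z * cnj (G z)) - ?n"
    unfolding circle_mean_add circle_mean_diff GS SG SS by simp
  also have "\<dots> = of_real (circle_mean N (\<lambda>z. (cmod (G z))\<^sup>2) - (\<Sum>k\<le>d. (cmod (c k))\<^sup>2))"
    by (simp add: circle_mean_of_real[symmetric] complex_norm_square del: of_real_power)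
  finally have "circle_mean N (\<lambda>z. (cmod (G z - S z))\<^sup>2)
      = circle_mean N (\<lambda>z. (cmod (G z))\<^sup>2) - (\<Sum>k\<le>d. (cmod (c k))\<^sup>2)"
    by (simp only: of_real_eq_iff)
  moreover have "circle_mean N (\<lambda>z. (cmod (G z - S z))\<^sup>2) \<ge> 0"
    by (intro circle_mean_nonneg) auto
  ultimately show ?thesis by (simp add: c_def)
qed

section \<open>Taylor coefficients as limits of circle means\<close>

text \<open>For \<open>N > k\<close> the terms of index below \<open>N\<close> yield
  \<open>g k\<close> exactly; only the tail can alias, and it contributes at most the absolute tail
  \<open>t N\<close>.\<close>

lemma circle_mean_coefficient_tendsto:
  fixes g :: "nat \<Rightarrow> complex"
  assumes "summable (\<lambda>n. cmod (g n))" and G: "\<And>z. cmod z = 1 \<Longrightarrow> (\<lambda>n. g n * z ^ n) sums G z"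
  shows "(\<lambda>N. circle_mean N (\<lambda>z. G z * cnj z ^ k)) \<longlonglongrightarrow> g k"
proof -
  define t where "t N = (\<Sum>n. cmod (g n)) - (\<Sum>n<N. cmod (g n))" for N
  have t0: "t \<longlonglongrightarrow> 0"
    unfolding t_def using tendsto_diff[OF tendsto_const[of "\<Sum>n. cmod (g n)"] summable_LIMSEQ[OF assms(1)]] by simp
  have "cmod (circle_mean N (\<lambda>z. G z * cnj z ^ k) - g k) \<le> t N" if N: "N > k" for N
  proof -
    have N0: "N > 0" using N by auto
    have tail: "cmod (G z - (\<Sum>n<N. g n * z ^ n)) \<le> t N" if z: "cmod z = 1" for z
    proof -
      have s: "summable (\<lambda>n. cmod (g n * z ^ n))" using assms(1) z by (simp add: norm_mult norm_power)
      hence s': "summable (\<lambda>n. cmod (g (n + N) * z ^ (n + N)))" by (rule summable_ignore_initial_segment)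
      have "G z - (\<Sum>n<N. g n * z ^ n) = (\<Sum>n. g (n + N) * z ^ (n + N))"
        using suminf_minus_initial_segment[OF sums_summable[OF G[OF z]], of N] sums_unique[OF G[OF z]] by simp
      hence "cmod (G z - (\<Sum>n<N. g n * z ^ n)) \<le> (\<Sum>n. cmod (g (n + N) * z ^ (n + N)))"
        using summable_norm[OF s'] by simp
      also have "\<dots> = t N"
        using suminf_minus_initial_segment[OF assms(1), of N] z by (simp add: t_def norm_mult norm_power)
      finally show ?thesis .
    qed
    have "circle_mean N (\<lambda>z. (\<Sum>n<N. g n * z ^ n) * cnj z ^ k)
        = circle_mean N (\<lambda>z. \<Sum>n<N. g n * (z ^ n * cnj z ^ k))"
      by (simp add: sum_distrib_right mult.assoc)
    also have "\<dots> = (\<Sum>n<N. g n * of_bool (n = k))"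
      unfolding circle_mean_sum circle_mean_cmult using N
      by (intro sum.cong refl) (subst circle_mean_orthonormal, auto)
    also have "\<dots> = g k" using N by simp
    finally have "circle_mean N (\<lambda>z. G z * cnj z ^ k) - g k
       = circle_mean N (\<lambda>z. (G z - (\<Sum>n<N. g n * z ^ n)) * cnj z ^ k)"
      unfolding left_diff_distrib circle_mean_diff by simp
    also have "cmod \<dots> \<le> circle_mean N (\<lambda>z. cmod ((G z - (\<Sum>n<N. g n * z ^ n)) * cnj z ^ k))"
      by (rule norm_circle_mean_le)
    also have "\<dots> \<le> circle_mean N (\<lambda>z. t N)"
      using tail roots_of_unity_norm[OF N0] by (intro circle_mean_mono) (simp add: norm_mult norm_power)
    finally show ?thesis using N0 by (simp add: circle_mean_const)
  qed
  hence "\<forall>\<^sub>F N in sequentially. norm (circle_mean N (\<lambda>z. G z * cnj z ^ k) - g k) \<le> t N"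
    by (intro eventually_mono[OF eventually_gt_at_top[of k]])
  from Lim_null_comparison[OF this t0] show ?thesis by (simp add: LIM_zero_iff)
qed

text \<open>Bessel's inequality with \<open>d\<close> fixed, then the limit along
  \<open>N i\<close>. The radius \<open>\<rho> < 1\<close> secures absolute convergence on the
  circle.\<close>

lemma power_series_bessel:
  fixes F :: "complex fps"
  assumes "f has_fps_expansion F" "f holomorphic_on ball 0 1" "0 < \<rho>" "\<rho> < 1"
    and N: "filterlim N at_top sequentially"
    and B: "\<And>i. circle_mean (N i) (\<lambda>z. (cmod (f (of_real \<rho> * z)))\<^sup>2) \<le> B"
  shows "(\<Sum>k\<le>d. (cmod (fps_nth F k) * \<rho> ^ k)\<^sup>2) \<le> B"
proof -
  let ?g = "\<lambda>n. fps_nth F n * of_real \<rho> ^ n"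
  have hol: "f holomorphic_on eball 0 1" using assms(2) by (simp add: one_ereal_def)
  have "fps_conv_radius F \<ge> 1" using assms(1) hol by (rule holomorphic_on_imp_fps_conv_radius_ge)
  hence "ereal 1 \<le> fps_conv_radius F" by (simp only: one_ereal_def)
  moreover have "ereal (norm (complex_of_real \<rho>)) < ereal 1" using assms(3,4) by simp
  ultimately have "ereal (norm (complex_of_real \<rho>)) < fps_conv_radius F" by (rule less_le_trans[rotated])
  hence summ: "summable (\<lambda>n. cmod (?g n))"
    unfolding fps_conv_radius_def by (rule abs_summable_in_conv_radius)
  have sums: "(\<lambda>n. ?g n * z ^ n) sums f (of_real \<rho> * z)" if "cmod z = 1" for z
    using has_fps_expansion_imp_sums_complex[OF assms(1) hol, of "of_real \<rho> * z"] assms(3,4) that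
    by (simp add: norm_mult power_mult_distrib mult.assoc one_ereal_def)
  let ?c = "\<lambda>N k. circle_mean N (\<lambda>z. f (of_real \<rho> * z) * cnj z ^ k)"
  have "(\<lambda>i. \<Sum>k\<le>d. (cmod (?c (N i) k))\<^sup>2) \<longlonglongrightarrow> (\<Sum>k\<le>d. (cmod (?g k))\<^sup>2)"
    by (intro tendsto_intros filterlim_compose[OF circle_mean_coefficient_tendsto[OF summ sums] N])
  moreover have "\<forall>\<^sub>F i in sequentially. (\<Sum>k\<le>d. (cmod (?c (N i) k))\<^sup>2) \<le> B"
    using eventually_compose_filterlim[OF eventually_gt_at_top[of d] N]
  proof eventually_elim
    case (elim i)
    show ?case using circle_mean_bessel[OF elim] B[of i] by (rule order_trans)
  qed
  ultimately have "(\<Sum>k\<le>d. (cmod (?g k))\<^sup>2) \<le> B"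
    by (rule tendsto_upperbound) auto
  thus ?thesis using assms(3) by (simp add: norm_mult norm_power)
qed

section \<open>Reflection of zeros and Carleman's inequality\<close>

lemma cmod_blaschke_le:
  assumes "cmod a < 1" "cmod z \<le> 1"
  shows "cmod (z - a) \<le> cmod (1 - cnj a * z)" and "cmod z = 1 \<Longrightarrow> cmod (z - a) = cmod (1 - cnj a * z)"
proof -
  \<comment> \<open>Both claims come from this identity: its right-hand side is nonnegative in the
    closed disc and zero on the circle.\<close>
  have *: "(cmod (1 - cnj a * z))\<^sup>2 - (cmod (z - a))\<^sup>2 = (1 - (cmod a)\<^sup>2) * (1 - (cmod z)\<^sup>2)"
    unfolding cmod_power2 by (simp add: algebra_simps power2_eq_square)
  have "(1 - (cmod a)\<^sup>2) * (1 - (cmod z)\<^sup>2) \<ge> 0"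
    using assms by (intro mult_nonneg_nonneg) (auto simp: power_le_one less_imp_le)
  with * have "(cmod (z - a))\<^sup>2 \<le> (cmod (1 - cnj a * z))\<^sup>2" by linarith
  thus "cmod (z - a) \<le> cmod (1 - cnj a * z)" by (rule power2_le_imp_le) simp
  show "cmod (z - a) = cmod (1 - cnj a * z)" if "cmod z = 1"
  proof -
    from * that have "(cmod (z - a))\<^sup>2 = (cmod (1 - cnj a * z))\<^sup>2" by simp
    thus ?thesis by (rule power2_eq_imp_eq) simp_all
  qed
qed

text \<open>Peel off linear factors. If \<open>cmod a < 1\<close>, the factor \<open>a - z\<close>
  becomes \<open>1 - cnj a * z\<close>, which has no zero in the disc, dominates there and has equal
  modulus on the circle. Other factors stay.\<close>

lemma poly_reflect_zeros:
  fixes p :: "complex poly"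
  assumes "p \<noteq> 0"
  shows "\<exists>q. (\<forall>z. cmod z < 1 \<longrightarrow> poly q z \<noteq> 0) \<and> (\<forall>z. cmod z \<le> 1 \<longrightarrow> cmod (poly p z) \<le> cmod (poly q z))
           \<and> (\<forall>z. cmod z = 1 \<longrightarrow> cmod (poly p z) = cmod (poly q z))"
  using assms
proof (induction p rule: poly_root_induct[where P = "\<lambda>_. True"])
  case (no_roots p)
  have "poly p z \<noteq> 0" for z using no_roots by auto
  thus ?case by blast
next
  case (root a p)
  hence "p \<noteq> 0" by auto
  then obtain q where q: "\<And>z. cmod z < 1 \<Longrightarrow> poly q z \<noteq> 0"
     "\<And>z. cmod z \<le> 1 \<Longrightarrow> cmod (poly p z) \<le> cmod (poly q z)"
     "\<And>z. cmod z = 1 \<Longrightarrow> cmod (poly p z) = cmod (poly q z)" using root.IH by blast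
  define r where "r = (if cmod a < 1 then [:1, - cnj a:] else [:a, -1:])"
  have r0: "poly r z \<noteq> 0" if "cmod z < 1" for z
  proof (cases "cmod a < 1")
    case True
    have "cmod (cnj a * z) < 1 * 1" unfolding norm_mult using True that by (intro mult_strict_mono') auto
    hence "cnj a * z \<noteq> 1" by auto
    thus ?thesis using True by (auto simp: r_def mult.commute)
  qed (use that in \<open>auto simp: r_def\<close>)
  have r1: "cmod (a - z) \<le> cmod (poly r z)" if "cmod z \<le> 1" for z
    using cmod_blaschke_le(1)[OF _ that, of a] by (auto simp: r_def norm_minus_commute mult.commute)
  have r2: "cmod (a - z) = cmod (poly r z)" if "cmod z = 1" for z
    using cmod_blaschke_le(2)[of a z] that by (auto simp: r_def norm_minus_commute mult.commute)
  show ?case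
    by (rule exI[of _ "r * q"])
       (use q r0 r1 r2 in \<open>auto simp: norm_mult simp flip: left_diff_distrib intro!: mult_mono\<close>)
qed auto

lemma poly_has_fps_expansion: "poly p has_fps_expansion fps_of_poly (p :: complex poly)"
proof (induction p)
  case (pCons a p)
  have "(\<lambda>z. a + z * poly p z) has_fps_expansion fps_const a + fps_X * fps_of_poly p"
    by (intro fps_expansion_intros pCons)
  thus ?case by (simp add: fps_of_poly_pCons mult.commute poly_pCons[abs_def])
qed (auto simp: poly_0[abs_def])

text \<open>The triangle \<open>i + j \<le> d\<close> lies in the square
  \<open>{..d} \<times> {..d}\<close>, and all terms are nonnegative.\<close>

lemma sum_convolution_le:
  fixes x y :: "nat \<Rightarrow> real"
  assumes "\<And>i. x i \<ge> 0" "\<And>i. y i \<ge> 0"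
  shows "(\<Sum>k\<le>d. \<Sum>i\<le>k. x i * y (k - i)) \<le> (\<Sum>i\<le>d. x i) * (\<Sum>j\<le>d. y j)"
proof -
  have "(\<Sum>k\<le>d. \<Sum>i\<le>k. x i * y (k - i)) = (\<Sum>(i, j)\<in>{(i, j). i + j \<le> d}. x i * y j)"
    by (rule sum.triangle_reindex_eq[symmetric])
  also have "\<dots> \<le> (\<Sum>(i, j)\<in>{..d} \<times> {..d}. x i * y j)"
    using assms by (intro sum_mono2) auto
  also have "\<dots> = (\<Sum>i\<le>d. x i) * (\<Sum>j\<le>d. y j)"
    by (simp add: sum_product sum.cartesian_product)
  finally show ?thesis .
qed

text \<open>
  With \<open>q\<close> the polynomial \<open>p\<close> whose zeros in the open disc are reflected at the unit circle, \<open>h = \<surd>q\<close>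
  and \<open>g = p/h\<close> satisfy \<open>|h|\<^sup>2 = |q|\<close> and \<open>|g|\<^sup>2 \<le> |q|\<close> in the disc, and the coefficients of
  \<open>p = g h\<close> are estimated by Cauchy-Schwarz. As \<open>q\<close> may vanish on the unit circle, all this happens on
  circles of radius \<open>\<rho> < 1\<close>.
\<close>

theorem carleman_inequality:
  fixes p :: "complex poly" and N :: "nat \<Rightarrow> nat"
  assumes N: "filterlim N at_top sequentially" "\<And>i. N i > 0"
    and B: "\<And>i. circle_mean (N i) (\<lambda>z. cmod (poly p z)) \<le> B"
  shows "(\<Sum>k\<le>d. (cmod (coeff p k))\<^sup>2 / (real k + 1)) \<le> B\<^sup>2"
proof (cases "p = 0")
  case False
  have "0 \<le> circle_mean (N 0) (\<lambda>z. cmod (poly p z))" by (intro circle_mean_nonneg) auto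
  hence B0: "B \<ge> 0" using B[of 0] by linarith
  obtain q where q: "\<And>z. cmod z < 1 \<Longrightarrow> poly q z \<noteq> 0"
     "\<And>z. cmod z \<le> 1 \<Longrightarrow> cmod (poly p z) \<le> cmod (poly q z)"
     "\<And>z. cmod z = 1 \<Longrightarrow> cmod (poly p z) = cmod (poly q z)"
    using poly_reflect_zeros[OF False] by blast
  obtain h where h: "h holomorphic_on ball 0 1" "\<And>z. z \<in> ball 0 1 \<Longrightarrow> poly q z = h z ^ 2"
  proof (rule contractible_imp_holomorphic_sqrt[of "poly q" "ball 0 1"])
    show "poly q holomorphic_on ball 0 1"
      by (intro holomorphic_on_subset[OF poly_holomorphic_on]) auto
  qed (use q(1) in \<open>auto intro: convex_imp_contractible\<close>)
  have h0: "h z \<noteq> 0" if "cmod z < 1" for z using h(2)[of z] q(1)[OF that] that by auto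
  define g where "g z = poly p z / h z" for z
  have g: "g holomorphic_on ball 0 1"
    unfolding g_def using h0 by (intro holomorphic_intros h) auto
  obtain H where H: "h has_fps_expansion H"
    using has_fps_expansion_fps_expansion[OF open_ball _ h(1)] by auto
  obtain G where G: "g has_fps_expansion G"
    using has_fps_expansion_fps_expansion[OF open_ball _ g] by auto
  have "(\<lambda>z. g z * h z) has_fps_expansion G * H" by (intro fps_expansion_intros G H)
  \<comment> \<open>Agreement near 0 suffices, since it determines the power series.\<close>
  moreover have "\<forall>\<^sub>F z in nhds 0. g z * h z = poly p z"
    using h0 by (auto simp: eventually_nhds g_def intro!: exI[of _ "ball 0 1"])
  ultimately have "poly p has_fps_expansion G * H"
    by (simp add: has_fps_expansion_cong[OF _ refl, of "\<lambda>z. g z * h z" "poly p"])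
  hence "fps_of_poly p = G * H" by (rule fps_expansion_unique_complex[OF poly_has_fps_expansion])
  hence coeff: "coeff p k = (\<Sum>i\<le>k. fps_nth G i * fps_nth H (k - i))" for k
    by (metis fps_of_poly_nth fps_mult_nth atMost_atLeast0)
  \<comment> \<open>Bounds the change of \<open>q\<close> from \<open>z\<close> to
    \<open>\<rho> z\<close> on the unit circle and vanishes as \<open>\<rho>\<close> tends to 1. It
    carries the mean bound for \<open>p\<close> on the unit circle over to \<open>q\<close> at
    radius \<open>\<rho>\<close>.\<close>
  define \<eta> where "\<eta> \<rho> = (\<Sum>k\<le>degree q. cmod (coeff q k) * (1 - \<rho> ^ k))" for \<rho> :: real
  have "(\<Sum>k\<le>d. (cmod (coeff p k) * \<rho> ^ k)\<^sup>2 / (real k + 1)) \<le> (B + \<eta> \<rho>)\<^sup>2" if \<rho>: "0 < \<rho>" "\<rho> < 1" for \<rho>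
  proof -
    have q_le: "cmod (poly q (of_real \<rho> * z)) \<le> cmod (poly p z) + \<eta> \<rho>" if z: "cmod z = 1" for z
    proof -
      have "cmod (poly q z - poly q (of_real \<rho> * z)) = cmod (\<Sum>k\<le>degree q. coeff q k * z ^ k * of_real (1 - \<rho> ^ k))"
        by (simp add: poly_altdef power_mult_distrib algebra_simps flip: sum_subtractf)
      also have "\<dots> \<le> (\<Sum>k\<le>degree q. cmod (coeff q k * z ^ k * of_real (1 - \<rho> ^ k)))"
        by (rule norm_sum)
      also have "\<dots> = \<eta> \<rho>"
        unfolding \<eta>_def norm_mult norm_of_real using z \<rho>
        by (intro sum.cong refl) (simp add: norm_power power_le_one)
      finally show ?thesis
        using q(3)[OF z] norm_triangle_ineq2[of "poly q (of_real \<rho> * z)" "poly q z"]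
        by (simp add: norm_minus_commute)
    qed
    have mean: "circle_mean (N i) (\<lambda>z. cmod (poly q (of_real \<rho> * z))) \<le> B + \<eta> \<rho>" for i
    proof -
      have "circle_mean (N i) (\<lambda>z. cmod (poly q (of_real \<rho> * z))) \<le> circle_mean (N i) (\<lambda>z. cmod (poly p z) + \<eta> \<rho>)"
        using roots_of_unity_norm[OF N(2)] by (intro circle_mean_mono q_le) blast
      also have "\<dots> \<le> B + \<eta> \<rho>"
        using B[of i] N(2) by (simp add: circle_mean_add circle_mean_const)
      finally show ?thesis .
    qed
    have in_disc: "cmod (of_real \<rho> * z) < 1" if "cmod z = 1" for z
      using that \<rho> by (simp add: norm_mult)
    have hq: "(cmod (h (of_real \<rho> * z)))\<^sup>2 = cmod (poly q (of_real \<rho> * z))" if "cmod z = 1" for z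
      using h(2)[of "of_real \<rho> * z"] in_disc[OF that] by (simp add: norm_power)
    have gq: "(cmod (g (of_real \<rho> * z)))\<^sup>2 \<le> cmod (poly q (of_real \<rho> * z))" if "cmod z = 1" for z
    proof -
      let ?w = "of_real \<rho> * z"
      have "(cmod (g ?w))\<^sup>2 = (cmod (poly p ?w))\<^sup>2 / cmod (poly q ?w)"
        using hq[OF that] by (simp add: g_def norm_divide power_divide)
      also have "\<dots> \<le> (cmod (poly q ?w))\<^sup>2 / cmod (poly q ?w)"
        using q(2)[of ?w] in_disc[OF that] by (intro divide_right_mono power_mono) auto
      also have "\<dots> = cmod (poly q ?w)" by (simp add: power2_eq_square)
      finally show ?thesis .
    qed
    have "circle_mean (N i) (\<lambda>z. (cmod (h (of_real \<rho> * z)))\<^sup>2) \<le> B + \<eta> \<rho>" for i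
      using roots_of_unity_norm[OF N(2)] hq
      by (intro order_trans[OF circle_mean_mono mean[of i]]) auto
    hence SH: "(\<Sum>k\<le>d. (cmod (fps_nth H k) * \<rho> ^ k)\<^sup>2) \<le> B + \<eta> \<rho>"
      by (intro power_series_bessel[OF H h(1) \<rho> N(1)])
    have "circle_mean (N i) (\<lambda>z. (cmod (g (of_real \<rho> * z)))\<^sup>2) \<le> B + \<eta> \<rho>" for i
      using roots_of_unity_norm[OF N(2)] gq
      by (intro order_trans[OF circle_mean_mono mean[of i]]) auto
    hence SG: "(\<Sum>k\<le>d. (cmod (fps_nth G k) * \<rho> ^ k)\<^sup>2) \<le> B + \<eta> \<rho>"
      by (intro power_series_bessel[OF G g \<rho> N(1)])
    let ?x = "\<lambda>k. (cmod (fps_nth G k) * \<rho> ^ k)\<^sup>2" and ?y = "\<lambda>k. (cmod (fps_nth H k) * \<rho> ^ k)\<^sup>2"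
    have "(cmod (coeff p k) * \<rho> ^ k)\<^sup>2 / (real k + 1) \<le> (\<Sum>i\<le>k. ?x i * ?y (k - i))" for k
    proof -
      have "cmod (coeff p k) * \<rho> ^ k \<le> (\<Sum>i\<le>k. cmod (fps_nth G i * fps_nth H (k - i))) * \<rho> ^ k"
        unfolding coeff using \<rho> by (intro mult_right_mono norm_sum) auto
      also have "\<dots> = (\<Sum>i\<le>k. 1 * ((cmod (fps_nth G i) * \<rho> ^ i) * (cmod (fps_nth H (k - i)) * \<rho> ^ (k - i))))"
        unfolding sum_distrib_right
        by (intro sum.cong refl) (simp add: norm_mult mult_ac flip: power_add)
      finally have "(cmod (coeff p k) * \<rho> ^ k)\<^sup>2 \<le>
          (\<Sum>i\<le>k. 1 * ((cmod (fps_nth G i) * \<rho> ^ i) * (cmod (fps_nth H (k - i)) * \<rho> ^ (k - i))))\<^sup>2"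
        using \<rho> by (intro power_mono) auto
      \<comment> \<open>The sum of \<open>k + 1\<close> ones is the source of the weight
        \<open>1 / (k + 1)\<close>.\<close>
      also have "\<dots> \<le> (\<Sum>i\<le>k. 1\<^sup>2) * (\<Sum>i\<le>k. ((cmod (fps_nth G i) * \<rho> ^ i) * (cmod (fps_nth H (k - i)) * \<rho> ^ (k - i)))\<^sup>2)"
        by (rule Cauchy_Schwarz_ineq_sum)
      finally show ?thesis by (simp add: power_mult_distrib field_simps)
    qed
    hence "(\<Sum>k\<le>d. (cmod (coeff p k) * \<rho> ^ k)\<^sup>2 / (real k + 1)) \<le> (\<Sum>k\<le>d. \<Sum>i\<le>k. ?x i * ?y (k - i))"
      by (rule sum_mono)
    also have "\<dots> \<le> (\<Sum>i\<le>d. ?x i) * (\<Sum>j\<le>d. ?y j)" by (intro sum_convolution_le) auto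
    also have "\<dots> \<le> (B + \<eta> \<rho>) * (B + \<eta> \<rho>)"
      using SG SH by (intro mult_mono) (auto intro!: sum_nonneg order_trans[OF _ SH])
    finally show ?thesis by (simp add: power2_eq_square)
  qed
  \<comment> \<open>The sums are finite, so \<open>\<rho>\<close> can tend to 1 termwise.\<close>
  hence ev: "\<forall>\<^sub>F \<rho> in at_left 1. (\<Sum>k\<le>d. (cmod (coeff p k) * \<rho> ^ k)\<^sup>2 / (real k + 1)) \<le> (B + \<eta> \<rho>)\<^sup>2"
    using eventually_at_left[of 0 "1::real"] by (auto intro!: exI[of _ 0])
  have 1: "((\<lambda>\<rho>. \<Sum>k\<le>d. (cmod (coeff p k) * \<rho> ^ k)\<^sup>2 / (real k + 1)) \<longlongrightarrow>
      (\<Sum>k\<le>d. (cmod (coeff p k) * 1 ^ k)\<^sup>2 / (real k + 1))) (at_left 1)"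
    by (intro tendsto_intros) auto
  have "((\<lambda>\<rho>. (B + \<eta> \<rho>)\<^sup>2) \<longlongrightarrow> (B + (\<Sum>k\<le>degree q. cmod (coeff q k) * (1 - 1 ^ k)))\<^sup>2) (at_left 1)"
    unfolding \<eta>_def by (intro tendsto_intros)
  hence 2: "((\<lambda>\<rho>. (B + \<eta> \<rho>)\<^sup>2) \<longlongrightarrow> B\<^sup>2) (at_left 1)" by simp
  show ?thesis using tendsto_le[OF _ 2 1 ev] by simp
qed auto

section \<open>Hypercontractivity on the torus\<close>

lemma norm_cis_diff_le: "cmod (cis x - cis y) \<le> \<bar>x - y\<bar>"
proof -
  have "cmod (cis x - cis y) = cmod (cis y * (cis (x - y) - 1))"
    by (simp add: cis_mult right_diff_distrib)
  also have "\<dots> = cmod (exp (\<i> * of_real (x - y)) - 1)"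
    by (simp add: norm_mult cis_conv_exp)
  also have "\<dots> = 2 * \<bar>sin ((x - y) / 2)\<bar>"
    using dist_exp_i_1[of "x - y"] by (simp add: dist_norm norm_minus_commute)
  also have "\<dots> \<le> \<bar>x - y\<bar>"
    using abs_sin_x_le_abs_x[of "(x - y) / 2"] by simp
  finally show ?thesis .
qed

text \<open>The \<open>N * M\<close> angles fall into \<open>N\<close> blocks of \<open>M\<close>;
  each point lies within \<open>2 * pi / N\<close> of the \<open>N\<close>-th root starting its
  block, and \<open>\<Sum>k\<le>d. k * cmod (a k)\<close> is a Lipschitz constant on the
  circle.\<close>

lemma circle_mean_refine_le:
  fixes a :: "nat \<Rightarrow> complex"
  assumes "N > 0" "M > 0"
  shows "circle_mean (N * M) (\<lambda>z. cmod (\<Sum>k\<le>d. a k * z ^ k))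
       \<le> circle_mean N (\<lambda>z. cmod (\<Sum>k\<le>d. a k * z ^ k)) + 2 * pi / N * (\<Sum>k\<le>d. k * cmod (a k))"
proof -
  let ?f = "\<lambda>z. \<Sum>k\<le>d. a k * z ^ k" and ?L = "\<Sum>k\<le>d. k * cmod (a k)"
  have lip: "cmod (?f z) \<le> cmod (?f w) + ?L * cmod (z - w)" if "cmod z = 1" "cmod w = 1" for z w
  proof -
    have "cmod (?f z - ?f w) = cmod (\<Sum>k\<le>d. a k * (z ^ k - w ^ k))"
      by (simp add: right_diff_distrib flip: sum_subtractf)
    also have "\<dots> \<le> (\<Sum>k\<le>d. cmod (a k) * cmod (z ^ k - w ^ k))"
      by (rule order_trans[OF norm_sum]) (simp add: norm_mult)
    also have "\<dots> \<le> (\<Sum>k\<le>d. cmod (a k) * (k * cmod (z - w)))"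
      using that by (intro sum_mono mult_left_mono norm_power_diff) auto
    also have "\<dots> = ?L * cmod (z - w)" unfolding sum_distrib_right by (simp add: mult_ac)
    finally show ?thesis using norm_triangle_ineq2[of "?f z" "?f w"] by linarith
  qed
  have L0: "?L \<ge> 0" by (intro sum_nonneg) auto
  let ?c = "\<lambda>j. cis (2 * pi * real j / real (N * M))" and ?e = "\<lambda>l. cis (2 * pi * real l / real N)"
  have near: "cmod (?f (?c j)) \<le> cmod (?f (?e l)) + 2 * pi / N * ?L" if "j \<in> {l * M..<l * M + M}" for j l
  proof -
    have "2 * pi * real j / real (N * M) - 2 * pi * real l / real N = 2 * pi / N * (real (j - l * M) / M)"
      using that assms by (simp add: of_nat_diff field_simps)
    moreover have "real (j - l * M) \<le> real M" unfolding of_nat_le_iff using that by auto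
    hence "real (j - l * M) / M \<le> 1" using assms by simp
    ultimately have "\<bar>2 * pi * real j / real (N * M) - 2 * pi * real l / real N\<bar> \<le> 2 * pi / N"
      using assms mult_left_mono[of "real (j - l * M) / M" 1 "2 * pi / N"] by (simp add: abs_mult)
    hence "cmod (?c j - ?e l) \<le> 2 * pi / N" using norm_cis_diff_le order_trans by blast
    hence "?L * cmod (?c j - ?e l) \<le> ?L * (2 * pi / N)" using L0 by (intro mult_left_mono)
    thus ?thesis using lip[of "?c j" "?e l"] by (simp add: mult.commute)
  qed
  have "(\<Sum>j<N * M. cmod (?f (?c j))) = (\<Sum>l<N. \<Sum>j\<in>{l * M..<l * M + M}. cmod (?f (?c j)))"
    by (rule sum.nat_group[symmetric])
  also have "\<dots> \<le> (\<Sum>l<N. \<Sum>j\<in>{l * M..<l * M + M}. cmod (?f (?e l)) + 2 * pi / N * ?L)"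
    by (intro sum_mono near)
  also have "\<dots> = M * ((\<Sum>l<N. cmod (?f (?e l))) + N * (2 * pi / N * ?L))"
  proof -
    have "(\<Sum>l<N. \<Sum>j\<in>{l * M..<l * M + M}. g l + E) = M * ((\<Sum>l<N. g l) + N * E)" for g :: "nat \<Rightarrow> real" and E :: real
      by (simp add: sum.distrib distrib_left flip: sum_distrib_left)
    thus ?thesis .
  qed
  finally have "(\<Sum>j<N * M. cmod (?f (?c j))) / real (N * M)
      \<le> (M * ((\<Sum>l<N. cmod (?f (?e l))) + N * (2 * pi / N * ?L))) / real (N * M)"
    by (intro divide_right_mono) auto
  also have "\<dots> = (\<Sum>l<N. cmod (?f (?e l))) / N + 2 * pi / N * ?L"
    using assms by (simp add: add_divide_distrib)
  finally show ?thesis using assms by (simp add: circle_mean_cis)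
qed

text \<open>
  The number \<open>N\<close> does not depend on \<open>a\<close>: passing from \<open>N\<close>-th to \<open>NM\<close>-th roots of unity costs a
  Lipschitz term \<open>O(1/N)\<close>, which is absorbed on the left-hand side.
\<close>

lemma hypercontractive_one_variable:
  fixes K :: real
  assumes "K > 1"
  obtains N where "N > 0" "\<And>a. L2_set (\<lambda>k. cmod (a k) * (1 / sqrt 2) ^ k) {..d}
      \<le> K * circle_mean N (\<lambda>z. cmod (\<Sum>k\<le>d. a k * z ^ k))"
proof -
  \<comment> \<open>As \<open>cmod (a k) \<le> sqrt 2 ^ k * A\<close> below, the refinement error is
    at most \<open>\<Lambda> / N * A\<close>. Choosing
    \<open>N \<ge> \<Lambda> * K / (K - 1)\<close> makes it at most
    \<open>(1 - 1 / K) * A\<close>.\<close>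
  define \<Lambda> where "\<Lambda> = 2 * pi * (\<Sum>k\<le>d. real k * sqrt 2 ^ k)"
  have \<Lambda>0: "\<Lambda> \<ge> 0" unfolding \<Lambda>_def by (intro mult_nonneg_nonneg sum_nonneg) auto
  obtain N :: nat where "max 1 (\<Lambda> * K / (K - 1)) < real N"
    using reals_Archimedean2 by blast
  hence N: "N > 0" "\<Lambda> * K / (K - 1) \<le> N" by auto
  show thesis
  proof (rule that[OF N(1)])
    fix a :: "nat \<Rightarrow> complex"
    let ?f = "\<lambda>z. \<Sum>k\<le>d. a k * z ^ k"
    define A where "A = L2_set (\<lambda>k. cmod (a k) * (1 / sqrt 2) ^ k) {..d}"
    have A0: "A \<ge> 0" by (simp add: A_def)
    define B where "B = circle_mean N (\<lambda>z. cmod (?f z)) + \<Lambda> / N * A"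
    have B0: "B \<ge> 0" unfolding B_def using \<Lambda>0 A0 by (intro add_nonneg_nonneg circle_mean_nonneg) auto
    have ak: "cmod (a k) \<le> sqrt 2 ^ k * A" if "k \<le> d" for k
    proof -
      have "cmod (a k) * (1 / sqrt 2) ^ k \<le> A"
        unfolding A_def using that by (intro member_le_L2_set) auto
      thus ?thesis by (simp add: power_divide field_simps)
    qed
    have "(\<Sum>k\<le>d. k * cmod (a k)) \<le> (\<Sum>k\<le>d. k * (sqrt 2 ^ k * A))"
      by (intro sum_mono mult_left_mono ak) auto
    hence "2 * pi / N * (\<Sum>k\<le>d. k * cmod (a k)) \<le> 2 * pi / N * (\<Sum>k\<le>d. k * (sqrt 2 ^ k * A))"
      by (intro mult_left_mono) auto
    also have "\<dots> = \<Lambda> / N * A"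
      by (simp add: \<Lambda>_def sum_distrib_left sum_distrib_right sum_divide_distrib mult_ac)
    finally have err: "2 * pi / N * (\<Sum>k\<le>d. k * cmod (a k)) \<le> \<Lambda> / N * A" .
    define p where "p = (\<Sum>k\<le>d. monom (a k) k)"
    have p_coeff: "coeff p k = (if k \<le> d then a k else 0)" for k
      by (simp add: p_def coeff_sum)
    have p: "poly p z = ?f z" for z by (simp add: p_def poly_sum poly_monom)
    \<comment> \<open>The multiples of \<open>N\<close> give the unbounded sequence of orders that
      Carleman's inequality asks for, all with the same bound \<open>B\<close>.\<close>
    have "circle_mean (N * Suc i) (\<lambda>z. cmod (poly p z)) \<le> B" for i
      unfolding p B_def by (rule order_trans[OF circle_mean_refine_le[OF N(1)]]) (use err in auto)
    moreover have "filterlim (\<lambda>i. N * Suc i) at_top sequentially"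
      using N(1) by (intro filterlim_subseq) (auto simp: strict_mono_def)
    ultimately have carl: "(\<Sum>k\<le>d. (cmod (coeff p k))\<^sup>2 / (real k + 1)) \<le> B\<^sup>2"
      using N(1) by (intro carleman_inequality[where N = "\<lambda>i. N * Suc i"]) auto
    have "A\<^sup>2 = (\<Sum>k\<le>d. (cmod (coeff p k))\<^sup>2 / 2 ^ k)"
      unfolding A_def L2_set_def
      by (simp add: sum_nonneg power_mult_distrib power_divide p_coeff flip: power_mult) (simp add: power_mult mult.commute[of _ 2])
    also have "\<dots> \<le> (\<Sum>k\<le>d. (cmod (coeff p k))\<^sup>2 / (real k + 1))"
    proof (intro sum_mono divide_left_mono)
      fix k :: nat
      \<comment> \<open>This trades Carleman's weight for the square of
        \<open>(1 / sqrt 2) ^ k\<close> and fixes the base \<open>sqrt 2\<close> of the final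
        estimate.\<close>
      have "Suc k \<le> 2 ^ k" using less_exp[of k] by (rule Suc_leI)
      thus "real k + 1 \<le> 2 ^ k" by (metis of_nat_Suc of_nat_le_iff of_nat_numeral of_nat_power add.commute)
    qed auto
    also have "\<dots> \<le> B\<^sup>2" by (rule carl)
    finally have "A \<le> B" using B0 by (rule power2_le_imp_le)
    hence "A \<le> circle_mean N (\<lambda>z. cmod (?f z)) + \<Lambda> / N * A" by (simp only: B_def)
    moreover have "\<Lambda> / N \<le> 1 - 1 / K"
      using N assms by (simp add: field_simps)
    hence "\<Lambda> / N * A \<le> (1 - 1 / K) * A" using A0 by (rule mult_right_mono)
    ultimately have "A / K \<le> circle_mean N (\<lambda>z. cmod (?f z))" by (simp add: algebra_simps)
    thus "L2_set (\<lambda>k. cmod (a k) * (1 / sqrt 2) ^ k) {..d} \<le> K * circle_mean N (\<lambda>z. cmod (?f z))"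
      using assms by (simp add: A_def field_simps)
  qed
qed

section \<open>Hypercontractivity in several variables\<close>

definition torus_mean :: "'i set \<Rightarrow> nat \<Rightarrow> (('i \<Rightarrow> complex) \<Rightarrow> real) \<Rightarrow> real" where
  "torus_mean V N \<phi> = (\<Sum>z\<in>PiE V (\<lambda>_. roots_of_unity N). \<phi> z) / real N ^ card V"

lemma sum_PiE_insert:
  fixes F :: "('i \<Rightarrow> 'a) \<Rightarrow> 'b::comm_monoid_add"
  assumes "x \<notin> V"
  shows "(\<Sum>\<alpha>\<in>PiE (insert x V) T. F \<alpha>) = (\<Sum>y\<in>T x. \<Sum>\<beta>\<in>PiE V T. F (\<beta>(x := y)))"
proof -
  have "(\<Sum>\<alpha>\<in>PiE (insert x V) T. F \<alpha>) = (\<Sum>p\<in>T x \<times> PiE V T. F ((\<lambda>(y, g). g(x := y)) p))"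
    unfolding PiE_insert_eq using sum.reindex[OF inj_combinator[OF assms, of T], of F] by simp
  also have "\<dots> = (\<Sum>y\<in>T x. \<Sum>\<beta>\<in>PiE V T. F (\<beta>(x := y)))"
    by (simp add: sum.cartesian_product case_prod_unfold)
  finally show ?thesis .
qed

lemma torus_mean_insert:
  assumes "finite V" "x \<notin> V"
  shows "torus_mean (insert x V) N \<phi> = torus_mean V N (\<lambda>z. circle_mean N (\<lambda>u. \<phi> (z(x := u))))"
  using assms unfolding torus_mean_def circle_mean_def sum_PiE_insert[OF assms(2)]
  by (subst sum.swap) (simp add: sum_divide_distrib mult.commute)

lemma torus_mean_mono:
  assumes "\<And>z. z \<in> PiE V (\<lambda>_. roots_of_unity N) \<Longrightarrow> \<phi> z \<le> \<psi> z"
  shows "torus_mean V N \<phi> \<le> torus_mean V N \<psi>"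
  unfolding torus_mean_def using assms by (intro divide_right_mono sum_mono) auto

lemma torus_mean_cmult: "torus_mean V N (\<lambda>z. c * \<phi> z) = c * torus_mean V N \<phi>"
  by (simp add: torus_mean_def sum_distrib_left)

lemma torus_mean_sum: "torus_mean V N (\<lambda>z. \<Sum>i\<in>I. \<phi> i z) = (\<Sum>i\<in>I. torus_mean V N (\<phi> i))"
  unfolding torus_mean_def by (subst sum.swap) (simp add: sum_divide_distrib)

lemma torus_mean_const: "finite V \<Longrightarrow> N > 0 \<Longrightarrow> torus_mean V N (\<lambda>_. c) = c"
  by (simp add: torus_mean_def card_PiE roots_of_unity_card)

lemma L2_set_sum_le:
  assumes "finite I"
  shows "L2_set (\<lambda>y. \<Sum>i\<in>I. f i y) A \<le> (\<Sum>i\<in>I. L2_set (f i) A)"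
  using assms
proof (induction I)
  case (insert i I)
  have "L2_set (\<lambda>y. f i y + (\<Sum>i\<in>I. f i y)) A \<le> L2_set (f i) A + L2_set (\<lambda>y. \<Sum>i\<in>I. f i y) A"
    by (rule L2_set_triangle_ineq)
  thus ?case using insert by simp
qed (simp add: L2_set_def)

text \<open>Minkowski's integral inequality in finite form, obtained from the triangle inequality
  for \<open>L2_set\<close>.\<close>

lemma L2_set_torus_mean_le:
  assumes "finite V" "N > 0"
  shows "L2_set (\<lambda>y. torus_mean V N (\<lambda>z. f z y)) A \<le> torus_mean V N (\<lambda>z. L2_set (f z) A)"
proof -
  have "L2_set (\<lambda>y. \<Sum>z\<in>PiE V (\<lambda>_. roots_of_unity N). f z y) A
     \<le> (\<Sum>z\<in>PiE V (\<lambda>_. roots_of_unity N). L2_set (f z) A)"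
    using assms by (intro L2_set_sum_le finite_PiE roots_of_unity_finite)
  moreover have "L2_set (\<lambda>y. torus_mean V N (\<lambda>z. f z y)) A
     = L2_set (\<lambda>y. \<Sum>z\<in>PiE V (\<lambda>_. roots_of_unity N). f z y) A / real N ^ card V"
    unfolding torus_mean_def divide_inverse using assms by (intro L2_set_left_distrib[symmetric]) auto
  ultimately show ?thesis unfolding torus_mean_def by (simp add: divide_right_mono)
qed

text \<open>Tensorization, at the cost of one factor \<open>K\<close> per variable. For each
  exponent \<open>y\<close> of the new variable the induction hypothesis handles the coefficient
  polynomial \<open>?G z y\<close>; Minkowski then moves the norm over \<open>y\<close> inside the
  torus mean.\<close>

lemma hypercontractive_torus:
  fixes K s :: real
  assumes "finite V" "N > 0" "K \<ge> 0" "s \<ge> 0"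
    and base: "\<And>a. L2_set (\<lambda>k. cmod (a k) * s ^ k) {..d}
                 \<le> K * circle_mean N (\<lambda>z. cmod (\<Sum>k\<le>d. a k * z ^ k))"
  shows "L2_set (\<lambda>\<alpha>. cmod (a \<alpha>) * s ^ (\<Sum>k\<in>V. \<alpha> k)) (PiE V (\<lambda>_. {..d}))
       \<le> K ^ card V * torus_mean V N (\<lambda>z. cmod (\<Sum>\<alpha>\<in>PiE V (\<lambda>_. {..d}). a \<alpha> * (\<Prod>k\<in>V. z k ^ \<alpha> k)))"
  using assms(1)
proof (induction V arbitrary: a)
  case empty
  show ?case by (simp add: L2_set_def torus_mean_def)
next
  case (insert x V)
  let ?P = "PiE V (\<lambda>_. {..d})"
  let ?G = "\<lambda>z y. \<Sum>\<beta>\<in>?P. a (\<beta>(x := y)) * (\<Prod>k\<in>V. z k ^ \<beta> k)"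
  have upd: "(\<Sum>k\<in>insert x V. (\<beta>(x := y)) k) = y + (\<Sum>k\<in>V. \<beta> k)" for \<beta> and y :: nat
  proof -
    have "(\<Sum>k\<in>V. (\<beta>(x := y)) k) = (\<Sum>k\<in>V. \<beta> k)" using insert.hyps by (intro sum.cong) auto
    thus ?thesis using insert.hyps by simp
  qed
  have "L2_set (\<lambda>\<alpha>. cmod (a \<alpha>) * s ^ (\<Sum>k\<in>insert x V. \<alpha> k)) (PiE (insert x V) (\<lambda>_. {..d}))
      = L2_set (\<lambda>y. L2_set (\<lambda>\<beta>. cmod (a (\<beta>(x := y))) * s ^ (\<Sum>k\<in>V. \<beta> k)) ?P * s ^ y) {..d}"
    unfolding L2_set_def sum_PiE_insert[OF insert.hyps(2)] upd
    by (simp add: power_mult_distrib sum_nonneg sum_distrib_left power_add mult_ac)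
  also have "\<dots> \<le> L2_set (\<lambda>y. K ^ card V * torus_mean V N (\<lambda>z. cmod (?G z y)) * s ^ y) {..d}"
    using assms(4) by (intro L2_set_mono mult_right_mono insert.IH) auto
  also have "\<dots> = K ^ card V * L2_set (\<lambda>y. torus_mean V N (\<lambda>z. cmod (?G z y) * s ^ y)) {..d}"
    using assms(3) by (subst L2_set_right_distrib) (simp_all add: torus_mean_cmult[symmetric] mult_ac)
  also have "\<dots> \<le> K ^ card V * torus_mean V N (\<lambda>z. L2_set (\<lambda>y. cmod (?G z y) * s ^ y) {..d})"
    using assms(3) insert.hyps assms(2) by (intro mult_left_mono L2_set_torus_mean_le) auto
  \<comment> \<open>For frozen \<open>z\<close> the numbers \<open>?G z y\<close> are the
    coefficients of a polynomial in the new variable \<open>u\<close>, so \<open>base\<close>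
    applies.\<close>
  also have "\<dots> \<le> K ^ card V * torus_mean V N (\<lambda>z. K * circle_mean N (\<lambda>u. cmod (\<Sum>y\<le>d. ?G z y * u ^ y)))"
    using assms(3) by (intro mult_left_mono torus_mean_mono base) auto
  also have "\<dots> = K ^ card (insert x V) * torus_mean V N (\<lambda>z. circle_mean N (\<lambda>u. cmod (\<Sum>y\<le>d. ?G z y * u ^ y)))"
    using insert.hyps by (simp add: torus_mean_cmult)
  also have "(\<lambda>z. circle_mean N (\<lambda>u. cmod (\<Sum>y\<le>d. ?G z y * u ^ y)))
      = (\<lambda>z. circle_mean N (\<lambda>u. cmod (\<Sum>\<alpha>\<in>PiE (insert x V) (\<lambda>_. {..d}). a \<alpha> * (\<Prod>k\<in>insert x V. (z(x := u)) k ^ \<alpha> k))))"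
  proof -
    have "(\<Prod>k\<in>insert x V. (z(x := u)) k ^ (\<beta>(x := y)) k) = u ^ y * (\<Prod>k\<in>V. z k ^ \<beta> k)" for z :: "'a \<Rightarrow> complex" and u \<beta> y
    proof -
      have "(\<Prod>k\<in>V. (z(x := u)) k ^ (\<beta>(x := y)) k) = (\<Prod>k\<in>V. z k ^ \<beta> k)"
        using insert.hyps by (intro prod.cong) auto
      thus ?thesis using insert.hyps by simp
    qed
    thus ?thesis unfolding sum_PiE_insert[OF insert.hyps(2)]
      by (simp add: sum_distrib_left mult_ac del: fun_upd_apply prod.insert)
  qed
  finally show ?case unfolding torus_mean_insert[OF insert.hyps] .
qed

section \<open>Homogeneous polynomials\<close>

lemma finite_Jset: "finite (Jset m n)"
  by (rule finite_subset[OF _ finite_lists_length_eq[of "{1..n}" m]]) (auto simp: Jset_def)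

lemma Jset_nth: "js \<in> Jset m n \<Longrightarrow> i < m \<Longrightarrow> js ! i \<in> {1..n}"
  unfolding Jset_def using nth_mem by blast

lemma prod_nth_eq_prod_count_list:
  fixes z :: "'a \<Rightarrow> 'b::comm_monoid_mult"
  assumes "finite A" "set js \<subseteq> A"
  shows "(\<Prod>i<length js. z (js ! i)) = (\<Prod>k\<in>A. z k ^ count_list js k)"
  using assms(2)
proof (induction js)
  case (Cons j js)
  have "(\<Prod>k\<in>A. z k ^ count_list (j # js) k) = (\<Prod>k\<in>A. (if k = j then z k else 1) * z k ^ count_list js k)"
    by (intro prod.cong) auto
  also have "\<dots> = z j * (\<Prod>k\<in>A. z k ^ count_list js k)"
    using assms(1) Cons.prems by (simp add: prod.distrib prod.delta)
  finally show ?case using Cons by (simp add: prod.lessThan_Suc_shift del: prod.lessThan_Suc)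
qed auto

text \<open>Used with constant 1 for the degree of a monomial and with general weights for Euler
  derivatives.\<close>

lemma sum_nth_eq_sum_count_list:
  fixes z :: "'a \<Rightarrow> 'b::comm_semiring_1"
  assumes "finite A" "set js \<subseteq> A"
  shows "(\<Sum>i<length js. z (js ! i)) = (\<Sum>k\<in>A. of_nat (count_list js k) * z k)"
  using assms(2)
proof (induction js)
  case (Cons j js)
  have "(\<Sum>k\<in>A. of_nat (count_list (j # js) k) * z k) = (\<Sum>k\<in>A. (if k = j then z k else 0) + of_nat (count_list js k) * z k)"
    by (intro sum.cong) (auto simp: algebra_simps)
  also have "\<dots> = z j + (\<Sum>k\<in>A. of_nat (count_list js k) * z k)"
    using assms(1) Cons.prems by (simp add: sum.distrib sum.delta)
  finally show ?case using Cons by (simp add: sum.lessThan_Suc_shift del: sum.lessThan_Suc)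
qed auto

text \<open>Sorted lists correspond injectively to exponent vectors via multiplicities. By
  homogeneity every exponent sums to \<open>m\<close>, so the damping is the single factor
  \<open>(1 / sqrt 2) ^ m\<close>.\<close>

lemma L2_set_coefficients_le_torus_mean:
  assumes "N > 0" "K \<ge> 0"
    and base: "\<And>a. L2_set (\<lambda>k. cmod (a k) * (1 / sqrt 2) ^ k) {..m}
                 \<le> K * circle_mean N (\<lambda>z. cmod (\<Sum>k\<le>m. a k * z ^ k))"
  shows "L2_set (\<lambda>js. cmod (c js)) (Jset m n) \<le> sqrt 2 ^ m * K ^ n * torus_mean {1..n} N (\<lambda>z. cmod (hpoly m n c z))"
proof -
  let ?V = "{1..n}" and ?P = "PiE {1..n} (\<lambda>_. {..m})"
  define e where "e js = restrict (count_list js) ?V" for js :: "nat list"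
  have inj: "inj_on e (Jset m n)"
  proof (rule inj_onI)
    fix x y assume xy: "x \<in> Jset m n" "y \<in> Jset m n" "e x = e y"
    have "count_list x k = count_list y k" for k
    proof (cases "k \<in> ?V")
      case True
      thus ?thesis using fun_cong[OF xy(3), of k] by (simp add: e_def)
    next
      case False
      hence "k \<notin> set x" "k \<notin> set y" using xy by (auto simp: Jset_def)
      thus ?thesis by simp
    qed
    hence "mset x = mset y" by (intro multiset_eqI) (simp add: count_mset)
    thus "x = y" using xy(1,2) properties_for_sort by (metis (no_types, lifting) Jset_def mem_Collect_eq)
  qed
  have e_in: "e js \<in> ?P" if "js \<in> Jset m n" for js
    using that count_le_length[of js] by (auto simp: e_def Jset_def)
  have e_sum: "(\<Sum>k\<in>?V. e js k) = m" if "js \<in> Jset m n" for js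
    using sum_nth_eq_sum_count_list[of ?V js "\<lambda>_. 1 :: nat"] that by (simp add: Jset_def e_def)
  have e_prod: "(\<Prod>k\<in>?V. z k ^ e js k) = (\<Prod>i<m. z (js ! i))" if "js \<in> Jset m n" for js and z :: "nat \<Rightarrow> complex"
    using prod_nth_eq_prod_count_list[of ?V js z] that by (simp add: Jset_def e_def)
  \<comment> \<open>Coefficients extended by zero from the degree-\<open>m\<close> exponents to the
    whole box.\<close>
  define a where "a \<alpha> = (if \<alpha> \<in> e ` Jset m n then c (the_inv_into (Jset m n) e \<alpha>) else 0)" for \<alpha>
  have a_e: "a (e js) = c js" if "js \<in> Jset m n" for js
    using that by (simp add: a_def the_inv_into_f_f[OF inj])
  have fin: "finite ?P" by (intro finite_PiE) auto
  have sub: "e ` Jset m n \<subseteq> ?P" using e_in by auto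
  have poly: "(\<Sum>\<alpha>\<in>?P. a \<alpha> * (\<Prod>k\<in>?V. z k ^ \<alpha> k)) = hpoly m n c z" for z
  proof -
    have "(\<Sum>\<alpha>\<in>?P. a \<alpha> * (\<Prod>k\<in>?V. z k ^ \<alpha> k)) = (\<Sum>\<alpha>\<in>e ` Jset m n. a \<alpha> * (\<Prod>k\<in>?V. z k ^ \<alpha> k))"
      using fin sub by (intro sum.mono_neutral_right) (auto simp: a_def)
    also have "\<dots> = (\<Sum>js\<in>Jset m n. c js * (\<Prod>i<m. z (js ! i)))"
      unfolding sum.reindex[OF inj] by (intro sum.cong refl) (simp only: o_apply a_e e_prod)
    finally show ?thesis by (simp add: hpoly_def)
  qed
  let ?s = "1 / sqrt 2 :: real"
  have "(\<Sum>\<alpha>\<in>?P. (cmod (a \<alpha>) * ?s ^ (\<Sum>k\<in>?V. \<alpha> k))\<^sup>2) = (\<Sum>\<alpha>\<in>e ` Jset m n. (cmod (a \<alpha>) * ?s ^ (\<Sum>k\<in>?V. \<alpha> k))\<^sup>2)"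
    using fin sub by (intro sum.mono_neutral_right) (auto simp: a_def)
  also have "\<dots> = (\<Sum>js\<in>Jset m n. (cmod (c js) * ?s ^ m)\<^sup>2)"
    unfolding sum.reindex[OF inj] by (intro sum.cong refl) (simp only: o_apply a_e e_sum)
  finally have "L2_set (\<lambda>js. cmod (c js) * ?s ^ m) (Jset m n)
      = L2_set (\<lambda>\<alpha>. cmod (a \<alpha>) * ?s ^ (\<Sum>k\<in>?V. \<alpha> k)) ?P"
    by (simp add: L2_set_def)
  also have "\<dots> \<le> K ^ n * torus_mean ?V N (\<lambda>z. cmod (hpoly m n c z))"
    using hypercontractive_torus[OF finite_atLeastAtMost assms(1,2) _ base, of a 1 n] unfolding poly by simp
  finally have "L2_set (\<lambda>js. cmod (c js)) (Jset m n) * ?s ^ m \<le> K ^ n * torus_mean ?V N (\<lambda>z. cmod (hpoly m n c z))"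
    by (simp add: L2_set_left_distrib)
  hence "sqrt 2 ^ m * (L2_set (\<lambda>js. cmod (c js)) (Jset m n) * ?s ^ m)
      \<le> sqrt 2 ^ m * (K ^ n * torus_mean ?V N (\<lambda>z. cmod (hpoly m n c z)))"
    by (intro mult_left_mono) auto
  thus ?thesis by (simp add: power_divide mult.assoc)
qed

section \<open>Sup norm and Euler derivatives\<close>

text \<open>The real supremum bounds its members once the range is bounded; the sum of the
  coefficient moduli is such a bound.\<close>

lemma hpoly_le_supnorm:
  assumes "\<And>k. k \<in> {1..n} \<Longrightarrow> cmod (z k) \<le> 1"
  shows "cmod (hpoly m n c z) \<le> supnorm m n c"
  unfolding supnorm_def
proof (rule cSUP_upper)
  show "bdd_above ((\<lambda>z. cmod (hpoly m n c z)) ` {z. \<forall>k\<in>{1..n}. cmod (z k) \<le> 1})"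
  proof (intro bdd_aboveI2)
    fix z :: "nat \<Rightarrow> complex" assume z: "z \<in> {z. \<forall>k\<in>{1..n}. cmod (z k) \<le> 1}"
    have "cmod (hpoly m n c z) \<le> (\<Sum>js\<in>Jset m n. cmod (c js) * (\<Prod>i<m. cmod (z (js ! i))))"
      unfolding hpoly_def by (rule order_trans[OF norm_sum]) (simp add: norm_mult prod_norm)
    also have "\<dots> \<le> (\<Sum>js\<in>Jset m n. cmod (c js) * 1)"
      using z Jset_nth by (intro sum_mono mult_left_mono prod_le_1) auto
    finally show "cmod (hpoly m n c z) \<le> (\<Sum>js\<in>Jset m n. cmod (c js) * 1)" .
  qed
qed (use assms in auto)

lemma supnorm_nonneg: "supnorm m n c \<ge> 0"
  using order_trans[OF norm_ge_zero hpoly_le_supnorm[of n "\<lambda>_. 0" m c]] by simp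

lemma hpoly_scale_le_supnorm:
  assumes "R > 0" "\<And>k. k \<in> {1..n} \<Longrightarrow> cmod (z k) \<le> R"
  shows "cmod (hpoly m n c z) \<le> R ^ m * supnorm m n c"
proof -
  have "hpoly m n c z = of_real R ^ m * hpoly m n c (\<lambda>k. z k / of_real R)"
    using assms(1) by (simp add: hpoly_def sum_distrib_left prod_dividef)
  moreover have "cmod (hpoly m n c (\<lambda>k. z k / of_real R)) \<le> supnorm m n c"
    using assms by (intro hpoly_le_supnorm) (simp add: norm_divide)
  ultimately show ?thesis using assms(1) by (simp add: norm_mult norm_power mult_left_mono)
qed

lemma prod_affine_has_derivative_at_0:
  fixes u w :: "nat \<Rightarrow> complex"
  shows "((\<lambda>t. \<Prod>i<m. u i * (1 + t * w i)) has_field_derivative (\<Prod>i<m. u i) * (\<Sum>i<m. w i)) (at 0)"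
proof (induction m)
  case (Suc m)
  have "((\<lambda>t. u m * (1 + t * w m)) has_field_derivative u m * w m) (at 0)"
    by (auto intro!: derivative_eq_intros)
  from DERIV_mult[OF Suc this] show ?case by (simp add: algebra_simps)
qed auto

lemma sum_euler_derivatives_le:
  assumes "m \<ge> 1" and z: "\<And>k. k \<in> {1..n} \<Longrightarrow> cmod (z k) \<le> 1"
  shows "(\<Sum>r\<in>{1..n}. cmod (hpoly m n (\<lambda>js. of_nat (count_list js r) * c js) z)) \<le> exp 1 * m * supnorm m n c"
proof -
  \<comment> \<open>Multiplying coefficients by the multiplicity of \<open>r\<close> is the operator
    of differentiating in \<open>z r\<close> and multiplying by \<open>z r\<close>.\<close>
  define Q where "Q r = hpoly m n (\<lambda>js. of_nat (count_list js r) * c js) z" for r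
  \<comment> \<open>The conjugate phase aligns all terms, so the derivative of \<open>\<phi>\<close>
    at 0 is the sum of the \<open>cmod (Q r)\<close>; \<open>w r\<close> is 0 where
    \<open>Q r\<close> is 0.\<close>
  define w where "w r = cnj (sgn (Q r))" for r
  define \<phi> where "\<phi> t = hpoly m n c (\<lambda>k. z k * (1 + t * w k))" for t
  have w: "cmod (w r) \<le> 1" for r by (simp add: w_def norm_sgn)
  have wQ: "w r * Q r = of_real (cmod (Q r))" for r
  proof -
    have "cnj (Q r) * Q r = (of_real (cmod (Q r)))\<^sup>2"
      by (metis complex_norm_square mult.commute of_real_power)
    thus ?thesis by (cases "Q r = 0") (simp_all add: w_def sgn_eq power2_eq_square)
  qed
  have "(\<phi> has_field_derivative (\<Sum>js\<in>Jset m n. c js * ((\<Prod>i<m. z (js ! i)) * (\<Sum>i<m. w (js ! i))))) (at 0)"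
    unfolding \<phi>_def hpoly_def
    by (intro DERIV_sum DERIV_cmult prod_affine_has_derivative_at_0)
  moreover have "(\<Sum>js\<in>Jset m n. c js * ((\<Prod>i<m. z (js ! i)) * (\<Sum>i<m. w (js ! i)))) = (\<Sum>r\<in>{1..n}. w r * Q r)"
  proof -
    have "(\<Sum>js\<in>Jset m n. c js * ((\<Prod>i<m. z (js ! i)) * (\<Sum>i<m. w (js ! i))))
        = (\<Sum>js\<in>Jset m n. c js * ((\<Prod>i<m. z (js ! i)) * (\<Sum>r\<in>{1..n}. of_nat (count_list js r) * w r)))"
    proof (intro sum.cong refl)
      fix js assume "js \<in> Jset m n"
      hence "(\<Sum>i<m. w (js ! i)) = (\<Sum>r\<in>{1..n}. of_nat (count_list js r) * w r)"
        using sum_nth_eq_sum_count_list[of "{1..n}" js w] by (simp add: Jset_def)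
      thus "c js * ((\<Prod>i<m. z (js ! i)) * (\<Sum>i<m. w (js ! i)))
        = c js * ((\<Prod>i<m. z (js ! i)) * (\<Sum>r\<in>{1..n}. of_nat (count_list js r) * w r))" by simp
    qed
    also have "\<dots> = (\<Sum>r\<in>{1..n}. w r * Q r)"
      unfolding Q_def hpoly_def sum_distrib_left by (subst sum.swap) (simp add: mult_ac)
    finally show ?thesis .
  qed
  ultimately have "deriv \<phi> 0 = (\<Sum>r\<in>{1..n}. w r * Q r)" by (metis DERIV_imp_deriv)
  hence d: "deriv \<phi> 0 = of_real (\<Sum>r\<in>{1..n}. cmod (Q r))" by (simp add: wQ)
  have hol: "\<phi> holomorphic_on A" for A
    unfolding \<phi>_def hpoly_def by (intro holomorphic_intros)
  define R where "R = 1 + 1 / real m"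
  have R: "R > 0" by (simp add: R_def add_pos_nonneg)
  have "cmod ((deriv ^^ 1) \<phi> 0) \<le> fact 1 * (R ^ m * supnorm m n c) / (1 / real m) ^ 1"
  proof (rule Cauchy_inequality)
    fix t :: complex assume t: "cmod (0 - t) = 1 / real m"
    show "cmod (\<phi> t) \<le> R ^ m * supnorm m n c"
      unfolding \<phi>_def
    proof (rule hpoly_scale_le_supnorm[OF R])
      fix k assume k: "k \<in> {1..n}"
      have "cmod (1 + t * w k) \<le> 1 + cmod t * cmod (w k)"
        using norm_triangle_ineq[of 1 "t * w k"] by (simp add: norm_mult)
      also have "\<dots> \<le> 1 + cmod t * 1" by (intro add_left_mono mult_left_mono w) auto
      finally have "cmod (1 + t * w k) \<le> R" using t by (simp add: R_def)
      hence "cmod (z k) * cmod (1 + t * w k) \<le> 1 * R" using z[OF k] by (intro mult_mono) auto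
      thus "cmod (z k * (1 + t * w k)) \<le> R" by (simp add: norm_mult)
    qed
  qed (use assms hol holomorphic_on_imp_continuous_on in auto)
  hence "cmod (deriv \<phi> 0) \<le> R ^ m * supnorm m n c * m" by simp
  also have "\<dots> \<le> exp 1 * supnorm m n c * m"
    using exp_ge_one_plus_x_over_n_power_n[of m 1] assms(1) supnorm_nonneg
    by (intro mult_right_mono) (auto simp: R_def)
  finally have "cmod (deriv \<phi> 0) \<le> exp 1 * supnorm m n c * m" .
  moreover have "cmod (deriv \<phi> 0) = (\<Sum>r\<in>{1..n}. cmod (Q r))"
    unfolding d norm_of_real by (simp add: sum_nonneg)
  ultimately show ?thesis unfolding Q_def by (simp add: mult_ac)
qed

section \<open>Combination of the estimates\<close>

text \<open>The 9 bounds two factors \<open>exp 1\<close>, from \<open>K ^ n\<close> and from the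
  Euler derivatives. The three powers of \<open>m\<close> come from \<open>sqrt m \<le> m\<close>,
  the \<open>m\<close> coordinates and the Euler derivatives.\<close>

lemma lorentz_norm_le_supnorm:
  assumes "m \<ge> 1"
  shows "lorentz_norm (2 * real m / (real m + 1)) (Jset m n) c \<le> 9 * real m ^ 3 * sqrt 2 ^ m * supnorm m n c"
proof (cases "n = 0")
  case True
  hence "Jset m n = {}" using assms by (auto simp: Jset_def)
  thus ?thesis using supnorm_nonneg[of m n c] by (simp add: lorentz_norm_def decr_rearr_def)
next
  case False
  let ?V = "{1..n}" and ?b = "\<lambda>js. cmod (c js)"
  define c' where "c' r js = of_nat (count_list js r) * c js" for r js
  \<comment> \<open>The loss \<open>K\<close> per variable must stay bounded over \<open>n\<close>
    variables; \<open>n = 0\<close> is separate because \<open>K > 1\<close> is required.\<close>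
  define K where "K = 1 + 1 / real n"
  have K: "K > 1" "K ^ n \<le> exp 1"
    using False exp_ge_one_plus_x_over_n_power_n[of n 1] by (simp_all add: K_def)
  obtain N where N: "N > 0" "\<And>a. L2_set (\<lambda>k. cmod (a k) * (1 / sqrt 2) ^ k) {..m}
      \<le> K * circle_mean N (\<lambda>z. cmod (\<Sum>k\<le>m. a k * z ^ k))"
    using hypercontractive_one_variable[OF K(1)] by blast
  define S where "S = (\<Sum>r\<in>?V. L2_set (\<lambda>js. cmod (c' r js)) (Jset m n))"
  \<comment> \<open>On the slice \<open>r\<close> occurs in \<open>js\<close>, so its multiplicity
    is at least 1. The bound no longer depends on \<open>k\<close>.\<close>
  have slice: "L2_set ?b {js \<in> Jset m n. js ! k = r} \<le> L2_set (\<lambda>js. cmod (c' r js)) (Jset m n)" if "k < m" for k r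
  proof -
    have "(\<Sum>js\<in>{js \<in> Jset m n. js ! k = r}. (?b js)\<^sup>2) \<le> (\<Sum>js\<in>{js \<in> Jset m n. js ! k = r}. (cmod (c' r js))\<^sup>2)"
    proof (intro sum_mono power_mono)
      fix js assume "js \<in> {js \<in> Jset m n. js ! k = r}"
      hence "r \<in> set js" using that by (auto simp: Jset_def)
      hence "1 \<le> real (count_list js r)" using count_list_0_iff[of js r] by (simp add: Suc_leI)
      thus "?b js \<le> cmod (c' r js)" using mult_right_mono[of 1 "real (count_list js r)" "?b js"]
        by (simp add: c'_def norm_mult)
    qed auto
    also have "\<dots> \<le> (\<Sum>js\<in>Jset m n. (cmod (c' r js))\<^sup>2)"
      using finite_Jset by (intro sum_mono2) auto
    finally show ?thesis by (simp add: L2_set_def)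
  qed
  have "lorentz_norm (2 * real m / (real m + 1)) (Jset m n) c
      \<le> sqrt m * (\<Sum>k<m. \<Sum>r\<in>?V. L2_set ?b {js \<in> Jset m n. js ! k = r})"
    using assms finite_Jset Jset_nth by (intro lorentz_norm_le_mixed_norms) (auto simp: Jset_def)
  also have "\<dots> \<le> sqrt m * (\<Sum>k<m. S)"
    unfolding S_def by (intro mult_left_mono sum_mono slice) auto
  finally have 1: "lorentz_norm (2 * real m / (real m + 1)) (Jset m n) c \<le> sqrt m * m * S" by simp
  have "S \<le> (\<Sum>r\<in>?V. sqrt 2 ^ m * K ^ n * torus_mean ?V N (\<lambda>z. cmod (hpoly m n (c' r) z)))"
    unfolding S_def using N K(1) by (intro sum_mono L2_set_coefficients_le_torus_mean) auto
  \<comment> \<open>The sum over \<open>r\<close> goes inside the mean, where the Euler bound holds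
    pointwise; this avoids a factor \<open>n\<close>.\<close>
  also have "\<dots> = sqrt 2 ^ m * K ^ n * torus_mean ?V N (\<lambda>z. \<Sum>r\<in>?V. cmod (hpoly m n (c' r) z))"
    by (simp add: torus_mean_sum sum_distrib_left)
  also have "\<dots> \<le> sqrt 2 ^ m * K ^ n * torus_mean ?V N (\<lambda>z. exp 1 * m * supnorm m n c)"
  proof (intro mult_left_mono torus_mean_mono)
    fix z assume "z \<in> PiE ?V (\<lambda>_. roots_of_unity N)"
    hence "cmod (z k) \<le> 1" if "k \<in> ?V" for k
      using roots_of_unity_norm[OF N(1), of "z k"] that by (auto simp: PiE_iff)
    thus "(\<Sum>r\<in>?V. cmod (hpoly m n (c' r) z)) \<le> exp 1 * m * supnorm m n c"
      unfolding c'_def by (intro sum_euler_derivatives_le assms)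
  qed (use K in auto)
  also have "\<dots> = sqrt 2 ^ m * K ^ n * (exp 1 * m * supnorm m n c)"
    using N by (simp add: torus_mean_const)
  also have "\<dots> \<le> sqrt 2 ^ m * exp 1 * (exp 1 * m * supnorm m n c)"
    using K supnorm_nonneg[of m n c] by (intro mult_right_mono mult_left_mono mult_nonneg_nonneg) auto
  also have "\<dots> = exp 1 * exp 1 * (sqrt 2 ^ m * m * supnorm m n c)" by simp
  also have "\<dots> \<le> 3 * 3 * (sqrt 2 ^ m * m * supnorm m n c)"
    using exp_le supnorm_nonneg[of m n c] by (intro mult_right_mono mult_mono mult_nonneg_nonneg) auto
  finally have 2: "S \<le> 9 * (sqrt 2 ^ m * m * supnorm m n c)" by simp
  have "sqrt m \<le> m"
    using assms by (intro real_le_lsqrt) (auto simp: power2_eq_square)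
  hence "sqrt m * m * S \<le> real m * m * (9 * (sqrt 2 ^ m * m * supnorm m n c))"
    using 2 by (intro mult_mono mult_right_mono) (auto simp: S_def sum_nonneg)
  with 1 show ?thesis by (simp add: power3_eq_cube mult_ac)
qed

theorem theorem5p2:
  "\<forall>\<epsilon>::real. \<epsilon> > 0 \<longrightarrow> (\<exists>C::real. C > 0 \<and>
     (\<forall>m::nat. m \<ge> 1 \<longrightarrow>
        BH_pol_lorentz (2 * real m / (real m + 1)) m \<le> ereal (C * (sqrt 2 + \<epsilon>) ^ m)))"
proof (intro allI impI)
  fix \<epsilon> :: real assume \<epsilon>: "\<epsilon> > 0"
  \<comment> \<open>The ratio is below 1, so \<open>x ^ m\<close> absorbs the polynomial factor
    \<open>m ^ 3\<close>.\<close>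
  define x where "x = sqrt 2 / (sqrt 2 + \<epsilon>)"
  have x: "0 < x" "x < 1" using \<epsilon> by (simp_all add: x_def add_pos_pos)
  have "(\<lambda>m. real m ^ 3 * x ^ m) \<longlonglongrightarrow> 0"     using x by real_asymp
  hence "Bseq (\<lambda>m. real m ^ 3 * x ^ m)" by (intro convergent_imp_Bseq convergentI)
  then obtain D where D: "D > 0" "\<And>m. real m ^ 3 * x ^ m \<le> D"
    unfolding Bseq_def using order_trans[OF abs_ge_self] by (metis real_norm_def)
  show "\<exists>C::real. C > 0 \<and> (\<forall>m::nat. m \<ge> 1 \<longrightarrow>
        BH_pol_lorentz (2 * real m / (real m + 1)) m \<le> ereal (C * (sqrt 2 + \<epsilon>) ^ m))"
  proof (intro exI[of _ "9 * D + 1"] conjI allI impI)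
    fix m :: nat assume m: "m \<ge> 1"
    let ?C = "(9 * D + 1) * (sqrt 2 + \<epsilon>) ^ m"
    have p: "sqrt 2 + \<epsilon> \<ge> 1" "sqrt 2 + \<epsilon> > 0" using \<epsilon> by (auto simp: add_increasing2 add_pos_pos)
    \<comment> \<open>Admissible constants must be at least 1, hence the summand 1 in
      \<open>9 * D + 1\<close>.\<close>
    have "1 * 1 \<le> ?C" using D p by (intro mult_mono one_le_power) auto
    moreover have "lorentz_norm (2 * real m / (real m + 1)) (Jset m n) c \<le> ?C * supnorm m n c" for n c
    proof -
      have "real m ^ 3 * sqrt 2 ^ m = (real m ^ 3 * x ^ m) * (sqrt 2 + \<epsilon>) ^ m"
        using p by (simp add: x_def power_divide)
      also have "\<dots> \<le> D * (sqrt 2 + \<epsilon>) ^ m" using D p by (intro mult_right_mono) auto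
      finally have "9 * real m ^ 3 * sqrt 2 ^ m \<le> 9 * D * (sqrt 2 + \<epsilon>) ^ m" by simp
      also have "\<dots> \<le> ?C" using p by (intro mult_right_mono) auto
      finally have "9 * real m ^ 3 * sqrt 2 ^ m * supnorm m n c \<le> ?C * supnorm m n c"
        using supnorm_nonneg by (rule mult_right_mono)
      with lorentz_norm_le_supnorm[OF m, of n c] show ?thesis by linarith
    qed
    ultimately show "BH_pol_lorentz (2 * real m / (real m + 1)) m \<le> ereal ?C"
      unfolding BH_pol_lorentz_def by (intro Inf_lower imageI) auto
  qed (use D in auto)
qed

end
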